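(* There is a distributed randomized algorithm (called ConnectBB) which, from a synchronized start and given a maximal independent set of the communication graph $G$ (each node knowing whether it belongs to it), computes a backbone $H$ of $G$ together with associated protocols Inter$_H$ and Intra$_H$, working in $O(\Delta\log^7N)$ rounds with high probability; the associated protocols have lengths $a_1=O(\log N)$ and $a_2=O(\Delta\log N)$.
   Context: Model: $n$ nodes in the Euclidean plane with unique names in $\{1,\dots,N\}$, $N\ge n$; synchronous rounds, each node transmits or listens, no collision detection; uniform power $P$, constants $\alpha>2$, $\mathcal{N}>0$, $\beta\ge1$, $\varepsilon\in(0,1)$, $r=(P/(\mathcal{N}\beta))^{1/\alpha}$; if set $\mathcal{T}$ transmits, $u\notin\mathcal{T}$ receives the message of $v\in\mathcal{T}$ iff $\frac{P\,\mathrm{dist}(v,u)^{-\alpha}}{\mathcal{N}+\sum_{w\in\mathcal{T}\setminus\{v\}}P\,\mathrm{dist}(w,u)^{-\alpha}}\ge\beta$ and $\mathrm{dist}(v,u)\le(1-\varepsilon)r$. Communication graph $G$: $u\sim v$ iff $\mathrm{dist}(u,v)\le(1-\varepsilon)r$; $\Delta$ its maximum degree. Nodes know only their own name, $N$ and $\Delta$; messages carry $O(\log N)$ control bits (plus possibly a rumor). Synchronized start: all nodes begin in the same round. Backbone of $G$: a subnetwork $H$ whose nodes form a connected dominating set of $G$ of asymptotically the same diameter as $G$, in which every node has a constant number of neighbors in $H$, with $|H|=O(m)$ where $m$ is the size of a smallest connected dominating set of $G$, and where every node of $G\setminus H$ is associated with exactly one of its neighbors in $H$ (its leader). Protocol Inter$_H$: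 a schedule of $a_1$ rounds during which every pair of neighbors in $H$ exchange messages, and every message received by $v\in H$ is delivered to all nodes whose leader is $v$. Protocol Intra$_H$: a schedule of $a_2$ rounds during which the message of each node is delivered to its leader. "With high probability": with probability at least $1-n^{-d}$ for a sufficiently large constant $d$. *)

theory Defs
  imports "HOL-Analysis.Analysis" "HOL-Probability.Probability"
begin

record sinr =
  pw    :: real
  alpha :: real
  noise :: real
  beta  :: real
  eps   :: real

type_synonym pt = "real ^ 2"

definition rng :: "sinr \<Rightarrow> real" where
  "rng M = (pw M / (noise M * beta M)) powr (1 / alpha M)"

definition sinr_rec :: "sinr \<Rightarrow> (nat \<Rightarrow> pt) \<Rightarrow> nat set \<Rightarrow> nat set \<Rightarrow> nat \<Rightarrow> nat \<Rightarrow> bool" where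
  "sinr_rec M pos V T v u \<longleftrightarrow>
     T \<subseteq> V \<and> v \<in> T \<and> u \<in> V \<and> u \<notin> T \<and>
     pw M * dist (pos v) (pos u) powr (- alpha M)
       / (noise M + (\<Sum>w\<in>T - {v}. pw M * dist (pos w) (pos u) powr (- alpha M))) \<ge> beta M \<and>
     dist (pos v) (pos u) \<le> (1 - eps M) * rng M"

definition comm_adj :: "sinr \<Rightarrow> (nat \<Rightarrow> pt) \<Rightarrow> nat set \<Rightarrow> nat \<Rightarrow> nat \<Rightarrow> bool" where
  "comm_adj M pos V u v \<longleftrightarrow> u \<in> V \<and> v \<in> V \<and> u \<noteq> v \<and> dist (pos u) (pos v) \<le> (1 - eps M) * rng M"

definition induced :: "(nat \<Rightarrow> nat \<Rightarrow> bool) \<Rightarrow> nat set \<Rightarrow> nat \<Rightarrow> nat \<Rightarrow> bool" where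
  "induced E S x y \<longleftrightarrow> E x y \<and> x \<in> S \<and> y \<in> S"

definition connected_on :: "(nat \<Rightarrow> nat \<Rightarrow> bool) \<Rightarrow> nat set \<Rightarrow> bool" where
  "connected_on E S \<longleftrightarrow> (\<forall>u\<in>S. \<forall>v\<in>S. (induced E S)\<^sup>*\<^sup>* u v)"

definition hop_dist :: "(nat \<Rightarrow> nat \<Rightarrow> bool) \<Rightarrow> nat set \<Rightarrow> nat \<Rightarrow> nat \<Rightarrow> nat" where
  "hop_dist E S u v = (LEAST k. (induced E S ^^ k) u v)"

definition diameter :: "(nat \<Rightarrow> nat \<Rightarrow> bool) \<Rightarrow> nat set \<Rightarrow> nat" where
  "diameter E S = Max {hop_dist E S u v | u v. u \<in> S \<and> v \<in> S}"

definition dominating :: "(nat \<Rightarrow> nat \<Rightarrow> bool) \<Rightarrow> nat set \<Rightarrow> nat set \<Rightarrow> bool" where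
  "dominating E V S \<longleftrightarrow> (\<forall>u\<in>V. u \<in> S \<or> (\<exists>v\<in>S. E u v))"

definition is_cds :: "(nat \<Rightarrow> nat \<Rightarrow> bool) \<Rightarrow> nat set \<Rightarrow> nat set \<Rightarrow> bool" where
  "is_cds E V S \<longleftrightarrow> S \<subseteq> V \<and> S \<noteq> {} \<and> connected_on E S \<and> dominating E V S"

definition min_cds_size :: "(nat \<Rightarrow> nat \<Rightarrow> bool) \<Rightarrow> nat set \<Rightarrow> nat" where
  "min_cds_size E V = Min (card ` {S. is_cds E V S})"

definition is_mis :: "(nat \<Rightarrow> nat \<Rightarrow> bool) \<Rightarrow> nat set \<Rightarrow> nat set \<Rightarrow> bool" where
  "is_mis E V I \<longleftrightarrow> I \<subseteq> V \<and> (\<forall>u\<in>I. \<forall>v\<in>I. \<not> E u v) \<and> (\<forall>u\<in>V - I. \<exists>v\<in>I. E u v)"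

definition max_degree :: "(nat \<Rightarrow> nat \<Rightarrow> bool) \<Rightarrow> nat set \<Rightarrow> nat" where
  "max_degree E V = Max ((\<lambda>u. card {v\<in>V. E u v}) ` V)"

text \<open>A uniform distributed algorithm: local states are nat lists (any countable local state).
  a_init name N Delta inMIS gives the initial state; in each round a node randomly
  (independently of all other nodes and rounds) updates its state and either transmits a message
  (Some m) or listens (None); a_recv processes the message heard (None = nothing heard; no collision
  detection). After a_rounds N Delta rounds the node outputs
  (in H?, leader, its transmission rounds in Inter_H, its transmission rounds in Intra_H).\<close>
record alg =
  a_init   :: "nat \<Rightarrow> nat \<Rightarrow> nat \<Rightarrow> bool \<Rightarrow> nat list"
  a_act    :: "nat list \<Rightarrow> (nat list \<times> nat option) pmf"
  a_recv   :: "nat list \<Rightarrow> nat option \<Rightarrow> nat list"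
  a_out    :: "nat list \<Rightarrow> bool \<times> nat \<times> nat set \<times> nat set"
  a_rounds :: "nat \<Rightarrow> nat \<Rightarrow> nat"

text \<open>One synchronous round; messages are truncated modulo B (bounded message size).\<close>
definition round_step ::
  "sinr \<Rightarrow> (nat \<Rightarrow> pt) \<Rightarrow> nat set \<Rightarrow> nat \<Rightarrow> alg \<Rightarrow> (nat \<Rightarrow> nat list) \<Rightarrow> (nat \<Rightarrow> nat list) pmf" where
  "round_step M pos V B A cfg =
     map_pmf (\<lambda>acts.
        let T = {v\<in>V. snd (acts v) \<noteq> None};
            heard = (\<lambda>u. if (\<exists>v. sinr_rec M pos V T v u)
                          then Some (the (snd (acts (SOME v. sinr_rec M pos V T v u))) mod B)
                          else None)
        in (\<lambda>u. if u \<in> V then a_recv A (fst (acts u)) (heard u) else cfg u))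
       (Pi_pmf V ([], None) (\<lambda>v. a_act A (cfg v)))"

definition run ::
  "sinr \<Rightarrow> (nat \<Rightarrow> pt) \<Rightarrow> nat set \<Rightarrow> nat \<Rightarrow> alg \<Rightarrow> (nat \<Rightarrow> nat list) \<Rightarrow> nat \<Rightarrow> (nat \<Rightarrow> nat list) pmf" where
  "run M pos V B A c0 t = ((\<lambda>p. bind_pmf p (round_step M pos V B A)) ^^ t) (return_pmf c0)"

definition backbone_ok ::
  "sinr \<Rightarrow> (nat \<Rightarrow> pt) \<Rightarrow> nat set \<Rightarrow> real \<Rightarrow> nat \<Rightarrow> nat \<Rightarrow> (nat \<Rightarrow> bool \<times> nat \<times> nat set \<times> nat set) \<Rightarrow> bool" where
  "backbone_ok M pos V cb a1 a2 out \<longleftrightarrow>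
    (let E = comm_adj M pos V;
         H = {v\<in>V. fst (out v)};
         ldr = (\<lambda>v. fst (snd (out v)));
         S1 = (\<lambda>i. {v\<in>V. i \<in> fst (snd (snd (out v)))});
         S2 = (\<lambda>i. {v\<in>V. i \<in> snd (snd (snd (out v)))});
         rcv = sinr_rec M pos V
     in is_cds E V H
      \<and> real (diameter E H) \<le> cb * real (diameter E V)
      \<and> (\<forall>u\<in>V. real (card {v\<in>H. E u v}) \<le> cb)
      \<and> real (card H) \<le> cb * real (min_cds_size E V)
      \<and> (\<forall>x\<in>V - H. ldr x \<in> H \<and> E x (ldr x))
      \<comment> \<open>Inter_H: neighbours in H exchange messages; what a leader receives is delivered to its dependents\<close>
      \<and> (\<forall>u\<in>H. \<forall>v\<in>H. E u v \<longrightarrow> (\<exists>i<a1. rcv (S1 i) v u))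
      \<and> (\<forall>x\<in>V - H. \<forall>i<a1. \<forall>w. rcv (S1 i) w (ldr x) \<longrightarrow>
            (\<exists>j. i < j \<and> j < a1 \<and> rcv (S1 j) (ldr x) x))
      \<comment> \<open>Intra_H: every node's message is delivered to its leader\<close>
      \<and> (\<forall>x\<in>V - H. \<exists>i<a2. rcv (S2 i) x (ldr x)))"

end

theory Submission
  imports Defs
begin

text \<open>In round \<open>0\<close> every node draws a tape, the random set of rounds in which it transmits, and it obeys
  the tape whether or not it has something to say. The pattern of receptions is therefore independent
  of the contents of the messages. With transmission probability \<open>\<kappa> / (\<Delta> + 1)\<close>, the expected number of
  close transmitters and the expected far interference (finite since \<open>\<alpha> > 2\<close>) are bounded, so by Markov's
  inequality a fixed transmission over a fixed edge succeeds with probability \<open>\<Omega>(1 / \<Delta>)\<close>. Hence \<open>O(\<Delta> log N)\<close>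
  rounds make all nodes deliver a message to all their neighbours with high probability, and such a
  phase is also a schedule for \<open>Intra\<close>.

  Five phases suffice to join any two dominators (nodes of the independent set) at distance at most
  three by a canonical path: a dominator selects the least suitable neighbour, which in turn selects its least
  suitable neighbour. As \<open>H\<close> is determined by the graph alone, the tape for \<open>Inter\<close> is independent
  of \<open>H\<close>; since \<open>H\<close> has constant density, \<open>O(log N)\<close> rounds with constant transmission probability suffice.\<close>

subsection \<open>Counting points in the plane\<close>

definition cell :: "real \<Rightarrow> pt \<Rightarrow> pt \<Rightarrow> int \<times> int" where
  "cell s z w = (\<lfloor>(w$1 - z$1) / s\<rfloor>, \<lfloor>(w$2 - z$2) / s\<rfloor>)"

lemma dist_pt_le: "dist x y \<le> \<bar>x$1 - y$1\<bar> + \<bar>x$2 - y$2\<bar>" for x y :: pt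
  using norm_le_l1_cart[of "x - y"] by (simp add: dist_norm sum_2)

lemma abs_component_le_dist: "\<bar>x$i - y$i\<bar> \<le> dist x y" for x y :: pt
  using component_le_norm_cart[of "x - y" i] by (simp add: dist_norm)

lemma floor_divide_eq_imp_abs_diff_less:
  fixes x y s :: real
  assumes "s > 0" "\<lfloor>x / s\<rfloor> = \<lfloor>y / s\<rfloor>"
  shows "\<bar>x - y\<bar> < s"
proof -
  have "\<bar>x / s - y / s\<bar> < 1" using assms(2) by linarith
  then have "\<bar>(x - y) / s\<bar> < 1" by (simp add: diff_divide_distrib)
  then show ?thesis using assms(1) by (simp add: abs_divide)
qed

lemma dist_le_if_same_cell:
  assumes "s > 0" "cell s z x = cell s z y"
  shows "dist x y \<le> 2 * s"
proof -
  have "\<bar>(x$i - z$i) - (y$i - z$i)\<bar> < s" if "i = 1 \<or> i = 2" for i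
    using floor_divide_eq_imp_abs_diff_less[OF assms(1), of "x$i - z$i" "y$i - z$i"] assms(2) that
    by (auto simp: cell_def)
  from this[of 1] this[of 2] show ?thesis using dist_pt_le[of x y] by simp
qed

text \<open>A grid square of side \<open>R / 2\<close> has diameter at most \<open>R\<close>, hence
  holds at most one point of \<open>S\<close>, and the ball meets only squares whose two indices lie
  between \<open>- 2 * k\<close> and \<open>2 * k\<close>.\<close>

lemma card_separated_le:
  fixes pos :: "nat \<Rightarrow> pt"
  assumes R: "R > 0"
    and sep: "\<And>x y. x \<in> S \<Longrightarrow> y \<in> S \<Longrightarrow> x \<noteq> y \<Longrightarrow> dist (pos x) (pos y) > R"
  shows "finite {w\<in>S. dist (pos w) z \<le> real k * R} \<and> card {w\<in>S. dist (pos w) z \<le> real k * R} \<le> (4*k+1)^2"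
proof -
  let ?s = "R / 2" and ?W = "{w\<in>S. dist (pos w) z \<le> real k * R}"
  let ?B = "{- 2 * int k..2 * int k} \<times> {- 2 * int k..2 * int k}"
  have inj: "inj_on (\<lambda>w. cell ?s z (pos w)) ?W"
  proof (rule inj_onI)
    fix x y assume *: "x \<in> ?W" "y \<in> ?W" "cell ?s z (pos x) = cell ?s z (pos y)"
    then have "dist (pos x) (pos y) \<le> R" using dist_le_if_same_cell[OF _ *(3)] R by simp
    then show "x = y" using sep[of x y] * by fastforce
  qed
  have fl: "\<lfloor>(pos w $ i - z $ i) / ?s\<rfloor> \<in> {- 2 * int k..2 * int k}" if "w \<in> ?W" for w i
  proof -
    have "\<bar>pos w $ i - z $ i\<bar> \<le> real k * R" using abs_component_le_dist[of "pos w" i z] that by simp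
    then have "\<bar>(pos w $ i - z $ i) / ?s\<bar> \<le> real k * R / ?s"
      unfolding abs_divide using R by (simp add: divide_right_mono del: divide_divide_eq_right)
    also have "\<dots> = 2 * real k" using R by simp
    finally have "\<bar>(pos w $ i - z $ i) / ?s\<bar> \<le> 2 * real k" .
    then show ?thesis unfolding abs_le_iff atLeastAtMost_iff by linarith
  qed
  have img: "(\<lambda>w. cell ?s z (pos w)) ` ?W \<subseteq> ?B"
    using fl unfolding cell_def by blast
  have "finite ?W" using inj img finite_subset[OF img] finite_imageD by blast
  moreover have "card ?W \<le> card ?B" using card_inj_on_le[OF inj img] by simp
  moreover have "card ?B = (4*k+1)^2" proof -
    have "nat (4 * int k + 1) = 4*k+1" by linarith
    then show ?thesis by (simp add: power2_eq_square card_cartesian_product)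
  qed
  ultimately show ?thesis by simp
qed

section \<open>Interference from far transmitters\<close>

definition zsum :: "real \<Rightarrow> real" where
  "zsum a = 2 * (\<Sum>n. (1 + real n) powr (- a))"

text \<open>The absolute value is injective on the nonnegative and on the negative integers, so each
  half is dominated by the series over the naturals.\<close>

lemma sum_int_le_zsum:
  assumes "a > 1" "finite A"
  shows "(\<Sum>k\<in>A. (1 + \<bar>real_of_int k\<bar>) powr (- a)) \<le> zsum a"
proof -
  let ?f = "\<lambda>n. (1 + real n) powr (- a)"
  have "summable (\<lambda>n. real n powr (- a))" using assms by (subst summable_real_powr_iff) auto
  then have sm: "summable ?f"
    using summable_Suc_iff[of "\<lambda>n. real n powr (- a)"] by (simp add: add.commute)
  have half: "(\<Sum>k\<in>B. (1 + \<bar>real_of_int k\<bar>) powr (- a)) \<le> suminf ?f"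
    if "finite B" "inj_on (\<lambda>k. nat \<bar>k\<bar>) B" for B
  proof -
    have "(\<Sum>k\<in>B. (1 + \<bar>real_of_int k\<bar>) powr (- a)) = sum ?f ((\<lambda>k. nat \<bar>k\<bar>) ` B)"
      using that by (subst sum.reindex) (auto intro!: sum.cong)
    also have "\<dots> \<le> suminf ?f" using that by (intro sum_le_suminf sm) auto
    finally show ?thesis .
  qed
  have "A = (A \<inter> {0..}) \<union> (A \<inter> {..<0})" by auto
  then have "(\<Sum>k\<in>A. (1 + \<bar>real_of_int k\<bar>) powr (- a)) =
     (\<Sum>k\<in>A \<inter> {0..}. (1 + \<bar>real_of_int k\<bar>) powr (- a)) + (\<Sum>k\<in>A \<inter> {..<0}. (1 + \<bar>real_of_int k\<bar>) powr (- a))"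
    using assms(2) by (subst (1) \<open>A = _\<close>, intro sum.union_disjoint) auto
  also have "\<dots> \<le> suminf ?f + suminf ?f"
    using assms(2) by (intro add_mono half) (auto simp: inj_on_def)
  finally show ?thesis by (simp add: zsum_def)
qed

lemma zsum_nonneg: "a > 1 \<Longrightarrow> zsum a \<ge> 0"
  using sum_int_le_zsum[of a "{}"] by simp

text \<open>Each grid square of side \<open>R / 2\<close> contains at most \<open>K\<close> far
  points. The distance of a far point dominates both of its grid indices; splitting the exponent
  \<open>al\<close> into halves bounds its term by one factor per coordinate, and both
  one-dimensional series converge because \<open>al/2 > 1\<close>.\<close>

lemma far_sum_le:
  fixes pos :: "nat \<Rightarrow> pt"
  assumes R: "R > 0" and al: "al > 2" and fin: "finite S" and K: "K \<ge> 0"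
    and dens: "\<And>z. z \<in> S \<Longrightarrow> real (card {w\<in>S. dist (pos w) (pos z) \<le> R}) \<le> K"
  shows "(\<Sum>w\<in>{w\<in>S. dist (pos w) z > R}. dist (pos w) z powr (- al))
           \<le> K * (2 powr al * (R / 2) powr (- al) * (zsum (al/2))\<^sup>2)"
proof -
  let ?s = "R / 2" and ?F = "{w\<in>S. dist (pos w) z > R}"
  let ?c = "\<lambda>w. cell ?s z (pos w)"
  let ?f = "\<lambda>k::int. (1 + \<bar>real_of_int k\<bar>) powr (- (al/2))"
  let ?C = "2 powr al * ?s powr (- al)"
  have summand: "dist (pos w) z powr (- al) \<le> ?C * (?f (fst (?c w)) * ?f (snd (?c w)))" if "w \<in> ?F" for w
  proof -
    let ?d = "dist (pos w) z"
    have d: "?d > R" using that by simp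
    \<comment> \<open>Rounding costs at most one unit and the summand 1 another, together
      \<open>2 * ?s = R\<close>, which is below \<open>?d\<close> because \<open>w\<close> is
      far.\<close>
    have one: "?s * (1 + \<bar>real_of_int \<lfloor>(pos w $ i - z $ i) / ?s\<rfloor>\<bar>) \<le> 2 * ?d" for i
    proof -
      let ?x = "pos w $ i - z $ i"
      have "\<bar>real_of_int \<lfloor>?x / ?s\<rfloor>\<bar> \<le> \<bar>?x / ?s\<bar> + 1" by linarith
      then have "?s * (1 + \<bar>real_of_int \<lfloor>?x / ?s\<rfloor>\<bar>) \<le> ?s * (\<bar>?x / ?s\<bar> + 2)"
        using R by (intro mult_left_mono) linarith+
      also have "\<dots> = \<bar>?x\<bar> + R" unfolding abs_divide using R by (simp add: distrib_left)
      also have "\<dots> \<le> 2 * ?d" using d abs_component_le_dist[of "pos w" i z] by simp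
      finally show ?thesis .
    qed
    let ?a = "1 + \<bar>real_of_int (fst (?c w))\<bar>" and ?b = "1 + \<bar>real_of_int (snd (?c w))\<bar>"
    have "(?s * ?a) * (?s * ?b) \<le> (2 * ?d) * (2 * ?d)"
    proof (rule mult_mono)
      show "?s * ?a \<le> 2 * ?d" using one[of 1] by (simp only: cell_def fst_conv)
      show "?s * ?b \<le> 2 * ?d" using one[of 2] by (simp only: cell_def snd_conv)
    qed (use R in auto)
    then have "(2 * ?d * (2 * ?d)) powr (- (al/2)) \<le> ((?s * ?a) * (?s * ?b)) powr (- (al/2))"
      using R al by (intro powr_mono2') auto
    moreover have "(2 * ?d * (2 * ?d)) powr (- (al/2)) = 2 powr (- al) * ?d powr (- al)"
    proof -
      have "(2 * ?d * (2 * ?d)) powr (- (al/2)) = (2 powr (- (al/2)) * 2 powr (- (al/2))) * (?d powr (- (al/2)) * ?d powr (- (al/2)))"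
        by (simp only: powr_mult mult_ac)
      then show ?thesis by (simp only: powr_add[symmetric]) simp
    qed
    moreover have "((?s * ?a) * (?s * ?b)) powr (- (al/2)) = ?s powr (- al) * (?f (fst (?c w)) * ?f (snd (?c w)))"
    proof -
      have "((?s * ?a) * (?s * ?b)) powr (- (al/2)) = (?s powr (- (al/2)) * ?s powr (- (al/2))) * (?a powr (- (al/2)) * ?b powr (- (al/2)))"
        using R by (simp only: powr_mult mult_ac)
      also have "?s powr (- (al/2)) * ?s powr (- (al/2)) = ?s powr (- al)"
        by (simp flip: powr_add)
      finally show ?thesis .
    qed
    ultimately have "2 powr (- al) * ?d powr (- al) \<le> ?s powr (- al) * (?f (fst (?c w)) * ?f (snd (?c w)))"
      by simp
    then have "2 powr al * (2 powr (- al) * ?d powr (- al)) \<le> 2 powr al * (?s powr (- al) * (?f (fst (?c w)) * ?f (snd (?c w))))"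
      by (intro mult_left_mono) auto
    then show ?thesis by (simp add: mult.assoc[symmetric] flip: powr_add)
  qed
  have finF: "finite ?F" using fin by simp
  \<comment> \<open>All points of one square lie within \<open>R\<close> of any one of them, so the
    density at a member bounds the square.\<close>
  have cellK: "real (card {w\<in>?F. ?c w = y}) \<le> K" for y
  proof (cases "{w\<in>?F. ?c w = y} = {}")
    case False
    then obtain w0 where w0: "w0 \<in> ?F" "?c w0 = y" by blast
    have "{w\<in>?F. ?c w = y} \<subseteq> {w\<in>S. dist (pos w) (pos w0) \<le> R}"
      using dist_le_if_same_cell[of ?s z] R w0 by fastforce
    then have "card {w\<in>?F. ?c w = y} \<le> card {w\<in>S. dist (pos w) (pos w0) \<le> R}"
      using fin by (intro card_mono) auto
    then show ?thesis using dens[of w0] w0 by simp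
  next
    case True
    then show ?thesis using K by (simp only: card.empty)
  qed
  let ?g = "\<lambda>y. ?f (fst y) * ?f (snd y)"
  \<comment> \<open>Enlarging the occupied squares to the product of their projections makes the
    double sum factorise.\<close>
  have "(\<Sum>y\<in>?c ` ?F. ?g y) \<le> (\<Sum>y\<in>fst ` ?c ` ?F \<times> snd ` ?c ` ?F. ?g y)"
    using finF by (intro sum_mono2 finite_cartesian_product finite_imageI subset_fst_snd) auto
  also have "\<dots> = (\<Sum>a\<in>fst ` ?c ` ?F. ?f a) * (\<Sum>b\<in>snd ` ?c ` ?F. ?f b)"
    by (simp add: sum_product sum.cartesian_product case_prod_beta)
  also have "\<dots> \<le> zsum (al/2) * zsum (al/2)"
    using al finF by (intro mult_mono sum_int_le_zsum zsum_nonneg sum_nonneg) auto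
  finally have cells: "(\<Sum>y\<in>?c ` ?F. ?g y) \<le> (zsum (al/2))\<^sup>2" by (simp add: power2_eq_square)
  have "(\<Sum>w\<in>?F. dist (pos w) z powr (- al)) \<le> (\<Sum>w\<in>?F. ?C * ?g (?c w))"
    by (intro sum_mono summand)
  also have "\<dots> = ?C * (\<Sum>w\<in>?F. ?g (?c w))" by (simp add: sum_distrib_left)
  finally have *: "(\<Sum>w\<in>?F. dist (pos w) z powr (- al)) \<le> ?C * (\<Sum>w\<in>?F. ?g (?c w))" .
  have "(\<Sum>w\<in>?F. ?g (?c w)) = (\<Sum>y\<in>?c ` ?F. \<Sum>w\<in>{w\<in>?F. ?c w = y}. ?g (?c w))"
    using finF by (rule sum.image_gen)
  also have "\<dots> = (\<Sum>y\<in>?c ` ?F. real (card {w\<in>?F. ?c w = y}) * ?g y)"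
    by (intro sum.cong refl) simp
  also have "\<dots> \<le> (\<Sum>y\<in>?c ` ?F. K * ?g y)"
    by (intro sum_mono mult_right_mono cellK) auto
  also have "\<dots> = K * (\<Sum>y\<in>?c ` ?F. ?g y)" by (simp add: sum_distrib_left)
  also have "\<dots> \<le> K * (zsum (al/2))\<^sup>2" using cells K by (rule mult_left_mono)
  finally have "?C * (\<Sum>w\<in>?F. ?g (?c w)) \<le> ?C * (K * (zsum (al/2))\<^sup>2)"
    by (rule mult_left_mono) simp
  from order_trans[OF * this] show ?thesis by (simp only: mult_ac)
qed

subsection \<open>Success probability of random transmissions\<close>

locale sinr_model =
  fixes M :: sinr
  assumes alpha: "alpha M > 2" and noise: "noise M > 0" and pw: "pw M > 0" and beta: "beta M \<ge> 1"
    and eps: "0 < eps M" "eps M < 1"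
begin

definition R :: real where "R = (1 - eps M) * rng M"

text \<open>The interference that a receiver at distance \<open>R\<close> tolerates.\<close>
definition theta :: real where "theta = noise M * ((1 - eps M) powr (- alpha M) - 1)"

text \<open>The bound of \<open>far_sum_le\<close> per unit of density.\<close>

definition farC :: real where
  "farC = 2 powr alpha M * (R / 2) powr (- alpha M) * (zsum (alpha M / 2))\<^sup>2"

text \<open>Chosen so that, with density at most \<open>K\<close> and coin bias
  \<open>kappa / K\<close>, the expected weight of the disturbances in \<open>success_prob\<close>
  is at most 1/2.\<close>

definition kappa :: real where "kappa = 1 / (2 * (1 + pw M / theta * farC))"

lemma R_pos: "R > 0"
  using noise pw beta eps by (simp add: R_def rng_def)

lemma theta_pos: "theta > 0"
proof -
  have "1 powr (- alpha M) < (1 - eps M) powr (- alpha M)"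
    using alpha eps by (intro powr_less_mono2_neg) auto
  then show ?thesis using noise by (simp add: theta_def)
qed

lemma farC_nonneg: "farC \<ge> 0"
  by (simp add: farC_def)

lemma kappa_pos: "kappa > 0" and kappa_le: "kappa \<le> 1/2"
proof -
  have "pw M / theta * farC \<ge> 0" using pw theta_pos farC_nonneg by simp
  moreover have "1 / (2 * (1 + c)) > 0 \<and> 1 / (2 * (1 + c)) \<le> 1/2" if "c \<ge> 0" for c :: real
    using that by (auto simp: field_simps)
  ultimately show "kappa > 0" "kappa \<le> 1/2" unfolding kappa_def by blast+
qed

text \<open>At distance \<open>rng M\<close> the signal is exactly \<open>beta M * noise M\<close>;
  shrinking the distance by the factor \<open>1 - eps M\<close> creates the slack that
  \<open>theta\<close> measures.\<close>

lemma signal_at_R: "pw M * R powr (- alpha M) = beta M * (noise M + theta)"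
proof -
  have "rng M powr (- alpha M) = (pw M / (noise M * beta M)) powr (- 1)"
    using alpha unfolding rng_def by (simp add: powr_powr)
  also have "\<dots> = noise M * beta M / pw M"
    using noise pw beta by (simp add: powr_minus_divide)
  finally have *: "rng M powr (- alpha M) = noise M * beta M / pw M" .
  have "R powr (- alpha M) = (1 - eps M) powr (- alpha M) * rng M powr (- alpha M)"
    by (simp add: R_def powr_mult)
  then show ?thesis using pw by (simp add: * theta_def algebra_simps)
qed

text \<open>The weakest admissible signal, at distance \<open>R\<close>, still tolerates
  interference \<open>theta\<close>. Positions must differ since \<open>0 powr x = 0\<close> would
  leave a sender at the receiver's own position without signal.\<close>

lemma sinr_recI:
  assumes "T \<subseteq> V" "v \<in> T" "u \<in> V" "u \<notin> T" "dist (pos v) (pos u) \<le> R" "pos v \<noteq> pos u"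
    and interference: "(\<Sum>w\<in>T - {v}. pw M * dist (pos w) (pos u) powr (- alpha M)) \<le> theta"
  shows "sinr_rec M pos V T v u"
proof -
  let ?X = "\<Sum>w\<in>T - {v}. pw M * dist (pos w) (pos u) powr (- alpha M)"
  have "?X \<ge> 0" using pw by (intro sum_nonneg) auto
  then have den: "noise M + ?X > 0" using noise by simp
  have "beta M * (noise M + ?X) \<le> beta M * (noise M + theta)"
    using interference beta by (intro mult_left_mono) auto
  also have "\<dots> = pw M * R powr (- alpha M)" by (simp add: signal_at_R)
  also have "\<dots> \<le> pw M * dist (pos v) (pos u) powr (- alpha M)"
    using assms(5,6) pw alpha by (intro mult_left_mono powr_mono2') auto
  finally have "beta M \<le> pw M * dist (pos v) (pos u) powr (- alpha M) / (noise M + ?X)"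
    using den by (simp add: pos_le_divide_eq)
  then show ?thesis using assms by (simp add: sinr_rec_def R_def)
qed

text \<open>As \<open>beta M \<ge> 1\<close> and the noise is positive, a received signal strictly
  exceeds each competing one, so two receptions would exceed each other. This determines the
  \<open>SOME\<close> in \<open>round_step\<close>.\<close>

lemma sinr_rec_unique:
  assumes "finite V" "sinr_rec M pos V T v u" "sinr_rec M pos V T v' u"
  shows "v = v'"
proof (rule ccontr)
  assume ne: "v \<noteq> v'"
  let ?s = "\<lambda>w. pw M * dist (pos w) (pos u) powr (- alpha M)"
  have fin: "finite T" using assms(1,2) finite_subset by (auto simp: sinr_rec_def)
  have s0: "?s w \<ge> 0" for w using pw by simp
  have "?s b < ?s a" if "sinr_rec M pos V T a u" "b \<in> T" "a \<noteq> b" for a b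
  proof -
    let ?X = "\<Sum>w\<in>T - {a}. ?s w"
    have X: "?s b \<le> ?X" using that fin s0 by (intro member_le_sum) auto
    have "1 \<le> ?s a / (noise M + ?X)" using that(1) beta by (simp add: sinr_rec_def)
    moreover have "noise M + ?X > 0" using X s0[of b] noise by linarith
    ultimately have "noise M + ?X \<le> ?s a" by (simp add: pos_le_divide_eq)
    then show ?thesis using X noise by linarith
  qed
  from this[OF assms(2), of v'] this[OF assms(3), of v] ne assms show False
    by (auto simp: sinr_rec_def)
qed

text \<open>The coin of \<open>v\<close> is independent of the others. Among these, a near
  transmitter gets weight 1 and a far one its interference relative to \<open>theta\<close>; total
  weight below 1 guarantees reception once \<open>v\<close> transmits, and by Markov's inequality it
  has probability at least 1/2.\<close>

lemma success_prob:
  fixes pos :: "nat \<Rightarrow> pt"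
  assumes fin: "finite V" and SV: "S \<subseteq> V" and v: "v \<in> S" and u: "u \<in> V" and inj: "inj_on pos V"
    and vu: "v \<noteq> u" and d: "dist (pos v) (pos u) \<le> R" and K: "K \<ge> 1" and p: "p = kappa / K"
    and dens: "\<And>z. z \<in> V \<Longrightarrow> real (card {w\<in>S. dist (pos w) (pos z) \<le> R}) \<le> K"
  shows "measure_pmf.prob (Pi_pmf V False (\<lambda>_. bernoulli_pmf p))
           {f. sinr_rec M pos V {w\<in>S. f w} v u} \<ge> p / 2"
proof -
  have p01: "0 \<le> p" "p \<le> 1" using kappa_pos kappa_le K unfolding p by (auto simp: field_simps)
  define V' where "V' = V - {v}"
  define Q where "Q = Pi_pmf V' False (\<lambda>_. bernoulli_pmf p)"
  let ?d = "\<lambda>w. dist (pos w) (pos u)"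
  define y where "y w = (if ?d w \<le> R then 1 else pw M * ?d w powr (- alpha M) / theta)" for w
  define Y where "Y f = (\<Sum>w\<in>S - {v}. of_bool (f w) * y w)" for f
  have y0: "y w \<ge> 0" for w using pw theta_pos by (simp add: y_def)
  have finS: "finite S" using fin SV finite_subset by blast
  have finV': "finite V'" using fin by (simp add: V'_def)
  have fset: "finite (set_pmf Q)" unfolding Q_def
    using finV' by (intro finite_subset[OF set_Pi_pmf_subset'] finite_PiE_dflt) auto
  have int: "integrable (measure_pmf Q) g" for g :: "_ \<Rightarrow> real"
    using fset by (rule integrable_measure_pmf_finite)
  have Eb: "measure_pmf.expectation Q (\<lambda>f. of_bool (f w) :: real) = p" if "w \<in> V'" for w
  proof -
    have "measure_pmf.expectation Q (\<lambda>f. of_bool (f w) :: real) = measure_pmf.expectation (map_pmf (\<lambda>f. f w) Q) of_bool"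
      by simp
    also have "map_pmf (\<lambda>f. f w) Q = bernoulli_pmf p"
      using that finV' unfolding Q_def by (simp add: Pi_pmf_component)
    finally show ?thesis using p01 by simp
  qed
  \<comment> \<open>Near nodes contribute at most \<open>K\<close> by the density around
    \<open>u\<close>, far ones are bounded by \<open>far_sum_le\<close>.\<close>
  have sumy: "(\<Sum>w\<in>S. y w) \<le> K * (1 + pw M / theta * farC)"
  proof -
    let ?N = "{w\<in>S. ?d w \<le> R}" and ?F = "{w\<in>S. ?d w > R}"
    have "(\<Sum>w\<in>S. y w) = sum y ?N + sum y ?F"
      using finS by (subst sum.union_disjoint[symmetric]) (auto intro!: sum.cong)
    also have "sum y ?N = real (card ?N)" by (simp add: y_def)
    also have "sum y ?F = pw M / theta * (\<Sum>w\<in>?F. ?d w powr (- alpha M))"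
      by (auto simp: y_def sum_distrib_left intro!: sum.cong)
    also have "\<dots> \<le> pw M / theta * (K * farC)"
      unfolding farC_def using pw theta_pos R_pos alpha K dens SV finS
      by (intro mult_left_mono far_sum_le) auto
    finally show ?thesis using dens[OF u] by (simp add: algebra_simps)
  qed
  have "measure_pmf.expectation Q Y = (\<Sum>w\<in>S - {v}. measure_pmf.expectation Q (\<lambda>f. of_bool (f w)) * y w)"
    unfolding Y_def using int by (subst Bochner_Integration.integral_sum) auto
  also have "\<dots> = p * (\<Sum>w\<in>S - {v}. y w)"
    unfolding sum_distrib_left
  proof (intro sum.cong refl)
    fix w assume "w \<in> S - {v}"
    then have "w \<in> V'" using SV by (auto simp: V'_def)
    then show "measure_pmf.expectation Q (\<lambda>f. of_bool (f w)) * y w = p * y w" by (simp only: Eb)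
  qed
  also have "\<dots> \<le> p * (\<Sum>w\<in>S. y w)"
    using p01 finS y0 by (intro mult_left_mono sum_mono2) auto
  also have "\<dots> \<le> p * (K * (1 + pw M / theta * farC))"
    using p01 sumy by (intro mult_left_mono)
  also have "\<dots> = 1/2"
  proof -
    have "1 + pw M / theta * farC > 0"
      using pw theta_pos farC_nonneg by (intro add_pos_nonneg) auto
    then show ?thesis using K unfolding p kappa_def by simp
  qed
  finally have EY: "measure_pmf.expectation Q Y \<le> 1/2" .
  have "measure_pmf.prob Q {f\<in>space (measure_pmf Q). Y f \<ge> 1} \<le> measure_pmf.expectation Q Y / 1"
    using y0 int by (intro integral_Markov_inequality_measure[where A="{}"]) (auto simp: Y_def intro!: sum_nonneg)
  then have bad: "measure_pmf.prob Q {f. Y f \<ge> 1} \<le> 1/2" using EY by simp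
  have "measure_pmf.prob Q {f. Y f < 1} = 1 - measure_pmf.prob Q {f. Y f \<ge> 1}"
    using measure_pmf.prob_compl[of "{f. Y f \<ge> 1}" Q] by (simp add: Collect_neg_eq[symmetric] not_le Compl_eq_Diff_UNIV[symmetric])
  then have good: "measure_pmf.prob Q {f. Y f < 1} \<ge> 1/2" using bad by simp
  let ?E = "{f. sinr_rec M pos V {w\<in>S. f w} v u}"
  have key: "f(v := True) \<in> ?E" if Yf: "Y f < 1" for f
  proof -
    let ?T = "{w\<in>S. (f(v := True)) w}"
    have far: "?d w > R" if "w \<in> ?T" "w \<noteq> v" for w
    proof (rule ccontr)
      assume "\<not> ?d w > R"
      then have "of_bool (f w) * y w = 1" using that by (simp add: y_def)
      moreover have "of_bool (f w) * y w \<le> Y f"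
        unfolding Y_def using that finS y0 by (intro member_le_sum) auto
      ultimately show False using Yf by simp
    qed
    have "(\<Sum>w\<in>?T - {v}. pw M * ?d w powr (- alpha M)) = theta * (\<Sum>w\<in>?T - {v}. of_bool (f w) * y w)"
      unfolding sum_distrib_left using far theta_pos
      by (intro sum.cong refl) (auto simp: y_def not_le[symmetric])
    also have "(\<Sum>w\<in>?T - {v}. of_bool (f w) * y w) \<le> Y f"
      unfolding Y_def using finS y0 by (intro sum_mono2) auto
    finally have X: "(\<Sum>w\<in>?T - {v}. pw M * ?d w powr (- alpha M)) \<le> theta"
      using Yf theta_pos by (smt (verit) mult_left_mono mult_cancel_left2)
    \<comment> \<open>\<open>u\<close> is within \<open>R\<close> of itself, so if it transmitted it
      would count as a near transmitter.\<close>
    have "u \<notin> ?T" using far[of u] vu R_pos by auto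
    moreover have "pos v \<noteq> pos u" using inj v SV u vu by (auto simp: inj_on_def)
    ultimately have "sinr_rec M pos V ?T v u"
      using SV v by (intro sinr_recI u d X) auto
    then show ?thesis by (simp only: mem_Collect_eq)
  qed
  have V: "V = insert v V'" and vV': "v \<notin> V'" using v SV by (auto simp: V'_def)
  let ?P = "pair_pmf (bernoulli_pmf p) Q"
  have "p / 2 \<le> p * measure_pmf.prob Q {f. Y f < 1}" using mult_left_mono[OF good p01(1)] by simp
  also have "\<dots> = measure_pmf.prob (bernoulli_pmf p) {True} * measure_pmf.prob Q ({f. Y f < 1} \<inter> set_pmf Q)"
    using p01 by (simp add: measure_Int_set_pmf measure_pmf_single)
  also have "\<dots> = measure_pmf.prob ?P ({True} \<times> ({f. Y f < 1} \<inter> set_pmf Q))"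
    by (intro measure_pmf_prob_product[symmetric]) auto
  also have "\<dots> \<le> measure_pmf.prob ?P ((\<lambda>(b, f). f(v := b)) -` ?E)"
    using key by (intro measure_pmf.finite_measure_mono) auto
  also have "\<dots> = measure_pmf.prob (map_pmf (\<lambda>(b, f). f(v := b)) ?P) ?E" by simp
  also have "map_pmf (\<lambda>(b, f). f(v := b)) ?P = Pi_pmf V False (\<lambda>_. bernoulli_pmf p)"
    unfolding V Q_def using finV' vV' by (simp add: Pi_pmf_insert)
  finally show ?thesis .
qed

end

subsection \<open>Random tapes\<close>

definition tape_pmf :: "(nat \<Rightarrow> real) \<Rightarrow> nat \<Rightarrow> nat set pmf" where
  "tape_pmf q n = map_pmf Collect (Pi_pmf {..<n} False (\<lambda>t. bernoulli_pmf (q t)))"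

lemma tape_pmf_finite: "\<tau> \<in> set_pmf (tape_pmf q n) \<Longrightarrow> finite \<tau>"
  using set_Pi_pmf_subset[of "{..<n}" False "\<lambda>t. bernoulli_pmf (q t)"]
  by (auto simp: tape_pmf_def intro!: finite_subset[of _ "{..<n}"])

text \<open>The algorithm draws the coins node by node, the analysis needs independence round by
  round. Both products assign the same mass to an array, up to the order of the factors.\<close>

lemma Pi_pmf_transpose:
  assumes A: "finite A" and B: "finite B"
  shows "map_pmf (\<lambda>h y x. h x y) (Pi_pmf A (\<lambda>_. d) (\<lambda>x. Pi_pmf B d (p x)))
         = Pi_pmf B (\<lambda>_. d) (\<lambda>y. Pi_pmf A d (\<lambda>x. p x y))"
proof (rule pmf_eqI)
  fix g :: "'b \<Rightarrow> 'a \<Rightarrow> 'c"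
  let ?sw = "\<lambda>h y x. h x y"
  have inj: "inj ?sw" by (rule injI) (metis ext)
  have "pmf (map_pmf ?sw (Pi_pmf A (\<lambda>_. d) (\<lambda>x. Pi_pmf B d (p x)))) (?sw (\<lambda>x y. g y x))
      = pmf (Pi_pmf A (\<lambda>_. d) (\<lambda>x. Pi_pmf B d (p x))) (\<lambda>x y. g y x)"
    by (rule pmf_map_inj'[OF inj])
  also have "\<dots> = pmf (Pi_pmf B (\<lambda>_. d) (\<lambda>y. Pi_pmf A d (\<lambda>x. p x y))) g"
  proof (cases "\<forall>x y. x \<notin> A \<or> y \<notin> B \<longrightarrow> g y x = d")
    case True
    then show ?thesis using A B by (simp add: pmf_Pi fun_eq_iff prod.swap[of _ B A])
  next
    case False
    \<comment> \<open>An entry off \<open>A \<times> B\<close> that differs from the default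
      \<open>d\<close> makes the mass zero on both sides, through the outer or the inner
      product.\<close>
    then obtain x y where xy: "x \<notin> A \<or> y \<notin> B" "g y x \<noteq> d" by blast
    have "pmf (Pi_pmf A (\<lambda>_. d) (\<lambda>x. Pi_pmf B d (p x))) (\<lambda>x y. g y x) = 0"
    proof (cases "x \<in> A")
      case True
      then have "pmf (Pi_pmf B d (p x)) (\<lambda>y. g y x) = 0" using xy B by (auto simp: pmf_Pi)
      then show ?thesis using True A by (auto simp: pmf_Pi intro!: prod_zero)
    qed (use xy A in \<open>auto simp: pmf_Pi fun_eq_iff\<close>)
    moreover have "pmf (Pi_pmf B (\<lambda>_. d) (\<lambda>y. Pi_pmf A d (\<lambda>x. p x y))) g = 0"
    proof (cases "y \<in> B")
      case True
      then have "pmf (Pi_pmf A d (\<lambda>x. p x y)) (g y) = 0" using xy A by (auto simp: pmf_Pi)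
      then show ?thesis using True B by (auto simp: pmf_Pi intro!: prod_zero)
    qed (use xy B in \<open>auto simp: pmf_Pi fun_eq_iff\<close>)
    ultimately show ?thesis by simp
  qed
  finally show "pmf (map_pmf ?sw (Pi_pmf A (\<lambda>_. d) (\<lambda>x. Pi_pmf B d (p x)))) g
      = pmf (Pi_pmf B (\<lambda>_. d) (\<lambda>y. Pi_pmf A d (\<lambda>x. p x y))) g" by simp
qed

lemma tapes_transpose:
  assumes "finite V"
  shows "map_pmf (\<lambda>\<tau> t v. t \<in> \<tau> v) (Pi_pmf V {} (\<lambda>_. tape_pmf q n))
       = Pi_pmf {..<n} (\<lambda>_. False) (\<lambda>t. Pi_pmf V False (\<lambda>_. bernoulli_pmf (q t)))"
proof -
  have "Pi_pmf V {} (\<lambda>_. tape_pmf q n)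
      = map_pmf (\<lambda>h. Collect \<circ> h) (Pi_pmf V (\<lambda>_. False) (\<lambda>_. Pi_pmf {..<n} False (\<lambda>t. bernoulli_pmf (q t))))"
    unfolding tape_pmf_def using assms by (intro Pi_pmf_map) auto
  then have "map_pmf (\<lambda>\<tau> t v. t \<in> \<tau> v) (Pi_pmf V {} (\<lambda>_. tape_pmf q n))
     = map_pmf (\<lambda>h y x. h x y) (Pi_pmf V (\<lambda>_. False) (\<lambda>_. Pi_pmf {..<n} False (\<lambda>t. bernoulli_pmf (q t))))"
    by (simp add: pmf.map_comp o_def)
  then show ?thesis using assms by (simp add: Pi_pmf_transpose)
qed

context sinr_model begin

text \<open>After the transposition the rounds are independent, so the failure probabilities from
  \<open>success_prob\<close> multiply over \<open>J\<close>.\<close>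

lemma tapes_fail_prob:
  fixes pos :: "nat \<Rightarrow> pt"
  assumes fin: "finite V" and SV: "S \<subseteq> V" and v: "v \<in> S" and u: "u \<in> V" and inj: "inj_on pos V"
    and vu: "v \<noteq> u" and d: "dist (pos v) (pos u) \<le> R" and K: "K \<ge> 1" and p: "p = kappa / K"
    and dens: "\<And>z. z \<in> V \<Longrightarrow> real (card {w\<in>S. dist (pos w) (pos z) \<le> R}) \<le> K"
    and J: "J \<subseteq> {..<n}" and q: "\<And>t. t \<in> J \<Longrightarrow> q t = p"
  shows "measure_pmf.prob (Pi_pmf V {} (\<lambda>_. tape_pmf q n))
           {\<tau>. \<forall>t\<in>J. \<not> sinr_rec M pos V {w\<in>S. t \<in> \<tau> w} v u} \<le> (1 - p / 2) ^ card J"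
proof -
  let ?rec = "\<lambda>f. sinr_rec M pos V {w\<in>S. f w} v u"
  let ?Q = "\<lambda>t. Pi_pmf V False (\<lambda>_. bernoulli_pmf (q t))"
  \<comment> \<open>Rounds outside \<open>J\<close> are unconstrained and contribute the factor
    1.\<close>
  let ?B = "\<lambda>t. if t \<in> J then {f. \<not> ?rec f} else UNIV"
  have "measure_pmf.prob (Pi_pmf V {} (\<lambda>_. tape_pmf q n)) {\<tau>. \<forall>t\<in>J. \<not> sinr_rec M pos V {w\<in>S. t \<in> \<tau> w} v u}
      = measure_pmf.prob (map_pmf (\<lambda>\<tau> t v. t \<in> \<tau> v) (Pi_pmf V {} (\<lambda>_. tape_pmf q n))) {g. \<forall>t\<in>J. \<not> ?rec (g t)}"
    by simp
  also have "\<dots> = measure_pmf.prob (Pi_pmf {..<n} (\<lambda>_. False) ?Q) {g. \<forall>t\<in>J. \<not> ?rec (g t)}"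
    using fin by (simp only: tapes_transpose)
  also have "{g. \<forall>t\<in>J. \<not> ?rec (g t)} = Pi {..<n} ?B"
    using J by (auto simp: Pi_def)
  also have "measure_pmf.prob (Pi_pmf {..<n} (\<lambda>_. False) ?Q) (Pi {..<n} ?B)
      = (\<Prod>t<n. measure_pmf.prob (?Q t) (?B t))"
    by (rule measure_Pi_pmf_Pi) simp
  also have "\<dots> = (\<Prod>t\<in>J. measure_pmf.prob (?Q t) (?B t))"
    using J by (intro prod.mono_neutral_right) auto
  also have "\<dots> \<le> (\<Prod>t\<in>J. 1 - p / 2)"
  proof (intro prod_mono conjI)
    fix t assume t: "t \<in> J"
    have "measure_pmf.prob (?Q t) {f. ?rec f} \<ge> p / 2"
      using success_prob[OF fin SV v u inj vu d K p dens] q[OF t] by simp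
    moreover have "measure_pmf.prob (?Q t) {f. \<not> ?rec f} = 1 - measure_pmf.prob (?Q t) {f. ?rec f}"
      using measure_pmf.prob_compl[of "{f. ?rec f}" "?Q t"]
      by (simp add: Collect_neg_eq Compl_eq_Diff_UNIV)
    ultimately show "measure_pmf.prob (?Q t) (?B t) \<le> 1 - p / 2" using t by simp
  qed simp
  finally show ?thesis by simp
qed

end

subsection \<open>The local rules of the backbone construction\<close>

text \<open>A node that has taken part in phases \<open>0, \<dots>, k - 1\<close> knows, for each phase \<open>j < k\<close>, the set
  \<open>R j\<close> of pairs (name, set of names) announced by its neighbours. The sets announced in the phases
  are: \<open>I\<close>-membership; the dominators; the dominators within one more hop; for a dominator, one
  selected neighbour per dominator reachable in three hops; for a selected node, one further node
  per dominator reachable in two hops.\<close>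

type_synonym knowledge = "nat \<Rightarrow> (nat \<times> nat set) set"

definition ann0 :: "nat \<Rightarrow> bool \<Rightarrow> nat set" where
  "ann0 v b = (if b then {v} else {})"

definition ann1 :: "nat \<Rightarrow> bool \<Rightarrow> knowledge \<Rightarrow> nat set" where
  "ann1 v b R = ann0 v b \<union> \<Union>(snd ` R 0)"

definition ann2 :: "knowledge \<Rightarrow> nat set" where
  "ann2 R = \<Union>(snd ` R (Suc 0))"

text \<open>The dominator itself is a candidate, which covers paths on which it takes the place of
  its neighbour. Taking minima makes the choice a function of the graph and the names.\<close>

definition ann3 :: "nat \<Rightarrow> bool \<Rightarrow> knowledge \<Rightarrow> nat set" where
  "ann3 v b R = (if b then (\<lambda>w. Min {a. \<exists>X. (a, X) \<in> insert (v, ann2 R) (R 2) \<and> w \<in> X}) ` (ann2 R \<union> \<Union>(snd ` R 2)) else {})"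

definition selected :: "nat \<Rightarrow> bool \<Rightarrow> knowledge \<Rightarrow> bool" where
  "selected v b R \<longleftrightarrow> v \<in> ann3 v b R \<union> \<Union>(snd ` R 3)"

definition ann4 :: "nat \<Rightarrow> bool \<Rightarrow> knowledge \<Rightarrow> nat set" where
  "ann4 v b R = (if selected v b R then (\<lambda>w. Min {c. \<exists>X. (c, X) \<in> R (Suc 0) \<and> w \<in> X}) ` ann2 R else {})"

definition announce :: "nat \<Rightarrow> nat \<Rightarrow> bool \<Rightarrow> knowledge \<Rightarrow> nat set" where
  "announce k v b R = (if k = 0 then ann0 v b else if k = Suc 0 then ann1 v b R else if k = 2 then ann2 R
     else if k = 3 then ann3 v b R else if k = 4 then ann4 v b R else {})"

definition in_backbone :: "nat \<Rightarrow> bool \<Rightarrow> knowledge \<Rightarrow> bool" where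
  "in_backbone v b R \<longleftrightarrow> b \<or> selected v b R \<or> v \<in> \<Union>(snd ` R 4)"

definition leader :: "nat \<Rightarrow> bool \<Rightarrow> knowledge \<Rightarrow> nat" where
  "leader v b R = Min (ann1 v b R)"

text \<open>The announcements of the ideal execution, in which every node hears all neighbours in
  every phase. The guard \<open>j < k\<close> makes the recursion terminate.\<close>

fun ann :: "(nat \<Rightarrow> nat set) \<Rightarrow> nat set \<Rightarrow> nat \<Rightarrow> nat \<Rightarrow> nat set" where
  "ann nb I k v = announce k v (v \<in> I) (\<lambda>j. if j < k then (\<lambda>w. (w, ann nb I j w)) ` nb v else {})"

declare ann.simps [simp del]

definition knows :: "(nat \<Rightarrow> nat set) \<Rightarrow> nat set \<Rightarrow> nat \<Rightarrow> nat \<Rightarrow> knowledge" where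
  "knows nb I k v = (\<lambda>j. if j < k then (\<lambda>w. (w, ann nb I j w)) ` nb v else {})"

lemma ann_eq_announce: "ann nb I k v = announce k v (v \<in> I) (knows nb I k v)"
  by (subst ann.simps) (simp add: knows_def)

lemma ann_0: "ann nb I 0 v = (if v \<in> I then {v} else {})"
  by (simp add: ann_eq_announce announce_def ann0_def)

text \<open>Knowledge of earlier phases is kept, so this and the analogous formulas below hold for
  every later \<open>k\<close>; they serve later announcements as well as the output at
  \<open>k = 5\<close>.\<close>

lemma ann1_knows: "0 < k \<Longrightarrow> ann1 v (v \<in> I) (knows nb I k v) = ann nb I 0 v \<union> \<Union>(ann nb I 0 ` nb v)"
  by (simp add: ann1_def knows_def ann_0 ann0_def image_image)

lemma ann_1: "ann nb I (Suc 0) v = ann nb I 0 v \<union> \<Union>(ann nb I 0 ` nb v)"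
  by (subst ann_eq_announce) (simp add: announce_def ann1_knows)

lemma ann2_knows: "Suc 0 < k \<Longrightarrow> ann2 (knows nb I k v) = \<Union>(ann nb I (Suc 0) ` nb v)"
  by (simp add: ann2_def knows_def image_image)

lemma ann_2: "ann nb I 2 v = \<Union>(ann nb I (Suc 0) ` nb v)"
  by (subst ann_eq_announce) (simp add: announce_def ann2_knows)

lemma ann3_knows: "2 < k \<Longrightarrow> ann3 v (v \<in> I) (knows nb I k v) =
   (if v \<in> I then (\<lambda>w. Min {a \<in> insert v (nb v). w \<in> ann nb I 2 a}) ` \<Union>(ann nb I 2 ` insert v (nb v)) else {})"
proof -
  assume k: "2 < k"
  have "ann2 (knows nb I k v) = ann nb I 2 v" using k by (simp add: ann2_knows ann_2)
  moreover have "{a. \<exists>X. (a, X) \<in> insert (v, ann nb I 2 v) (knows nb I k v 2) \<and> w \<in> X} = {a \<in> insert v (nb v). w \<in> ann nb I 2 a}" for w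
    using k by (auto simp: knows_def)
  moreover have "\<Union>(snd ` knows nb I k v 2) = \<Union>(ann nb I 2 ` nb v)"
    using k by (simp add: knows_def image_image)
  ultimately show ?thesis by (simp add: ann3_def)
qed

lemma ann_3: "ann nb I 3 v =
   (if v \<in> I then (\<lambda>w. Min {a \<in> insert v (nb v). w \<in> ann nb I 2 a}) ` \<Union>(ann nb I 2 ` insert v (nb v)) else {})"
  by (subst ann_eq_announce) (simp add: announce_def ann3_knows)

lemma selected_knows: "3 < k \<Longrightarrow> selected v (v \<in> I) (knows nb I k v) \<longleftrightarrow> v \<in> \<Union>(ann nb I 3 ` insert v (nb v))"
  unfolding selected_def by (simp only: ann3_knows ann_3[symmetric]) (simp add: knows_def image_image)

lemma ann4_knows: "3 < k \<Longrightarrow> ann4 v (v \<in> I) (knows nb I k v) =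
   (if v \<in> \<Union>(ann nb I 3 ` insert v (nb v)) then (\<lambda>w. Min {c \<in> nb v. w \<in> ann nb I (Suc 0) c}) ` ann nb I 2 v else {})"
proof -
  assume k: "3 < k"
  have "{c. \<exists>X. (c, X) \<in> knows nb I k v (Suc 0) \<and> w \<in> X} = {c \<in> nb v. w \<in> ann nb I (Suc 0) c}" for w
    using k by (auto simp: knows_def)
  moreover have "ann2 (knows nb I k v) = ann nb I 2 v" using k by (simp add: ann2_knows ann_2)
  ultimately show ?thesis unfolding ann4_def by (simp only: selected_knows[OF k])
qed

lemma ann_4: "ann nb I 4 v =
   (if v \<in> \<Union>(ann nb I 3 ` insert v (nb v)) then (\<lambda>w. Min {c \<in> nb v. w \<in> ann nb I (Suc 0) c}) ` ann nb I 2 v else {})"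
  by (subst ann_eq_announce) (simp only: announce_def ann4_knows, simp)

lemma in_backbone_knows: "in_backbone v (v \<in> I) (knows nb I 5 v) \<longleftrightarrow>
   v \<in> I \<or> v \<in> \<Union>(ann nb I 3 ` insert v (nb v)) \<or> v \<in> \<Union>(ann nb I 4 ` nb v)"
  unfolding in_backbone_def by (subst selected_knows) (simp_all add: knows_def image_image)

lemma leader_knows: "leader v (v \<in> I) (knows nb I 5 v) = Min (ann nb I (Suc 0) v)"
  by (simp add: leader_def ann1_knows ann_1)

lemma ann_ge5: "5 \<le> k \<Longrightarrow> ann nb I k v = {}"
  by (subst ann_eq_announce) (simp add: announce_def)

subsection \<open>Correctness of the backbone construction\<close>

definition reach :: "(nat \<Rightarrow> nat \<Rightarrow> bool) \<Rightarrow> nat set \<Rightarrow> nat \<Rightarrow> nat \<Rightarrow> nat \<Rightarrow> bool" where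
  "reach E S k u v \<longleftrightarrow> (\<exists>j\<le>k. (induced E S ^^ j) u v)"

lemma reach_refl: "reach E S k u u"
  unfolding reach_def by (intro exI[of _ 0]) simp

lemma reach_trans: "reach E S k u v \<Longrightarrow> reach E S l v w \<Longrightarrow> reach E S (k + l) u w"
proof -
  assume "reach E S k u v" "reach E S l v w"
  then obtain i j where "i \<le> k" "j \<le> l" "(induced E S ^^ i) u v" "(induced E S ^^ j) v w"
    by (auto simp: reach_def)
  then have "i + j \<le> k + l" "(induced E S ^^ (i + j)) u w" by (auto simp: relpowp_add)
  then show ?thesis unfolding reach_def by blast
qed

lemma reach_mono: "reach E S k u v \<Longrightarrow> k \<le> l \<Longrightarrow> reach E S l u v"
  unfolding reach_def by (meson le_trans)

lemma reach_edge: "u = v \<or> E u v \<Longrightarrow> u \<in> S \<Longrightarrow> v \<in> S \<Longrightarrow> reach E S 1 u v"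
proof -
  assume *: "u = v \<or> E u v" "u \<in> S" "v \<in> S"
  show ?thesis
  proof (cases "u = v")
    case False
    then have "(induced E S ^^ 1) u v" unfolding relpowp_1 using * by (simp add: induced_def)
    then show ?thesis unfolding reach_def by blast
  qed (simp add: reach_refl)
qed

lemma reach_imp_rtranclp: "reach E S k u v \<Longrightarrow> (induced E S)\<^sup>*\<^sup>* u v"
  unfolding reach_def by (auto dest: relpowp_imp_rtranclp)

lemma hop_dist_le: "reach E S k u v \<Longrightarrow> hop_dist E S u v \<le> k"
  unfolding reach_def hop_dist_def by (meson Least_le order_trans)

lemma hop_dist_relpow: "(induced E S)\<^sup>*\<^sup>* u v \<Longrightarrow> (induced E S ^^ hop_dist E S u v) u v"
  unfolding hop_dist_def by (rule LeastI_ex) (rule rtranclp_imp_relpowp)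

lemma hop_dist_le_diameter:
  assumes "finite S" "u \<in> S" "v \<in> S"
  shows "hop_dist E S u v \<le> diameter E S"
proof -
  have "{hop_dist E S u v | u v. u \<in> S \<and> v \<in> S} = (\<lambda>(u, v). hop_dist E S u v) ` (S \<times> S)" by auto
  then show ?thesis unfolding diameter_def using assms by (intro Max_ge) auto
qed

lemma diameter_le:
  assumes "finite S" "S \<noteq> {}" "\<And>u v. u \<in> S \<Longrightarrow> v \<in> S \<Longrightarrow> hop_dist E S u v \<le> b"
  shows "diameter E S \<le> b"
proof -
  have "{hop_dist E S u v | u v. u \<in> S \<and> v \<in> S} = (\<lambda>(u, v). hop_dist E S u v) ` (S \<times> S)" by auto
  then show ?thesis unfolding diameter_def using assms by (subst Max_le_iff) auto
qed

lemma card_UN_le_mult: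
  assumes "finite A" "\<And>a. a \<in> A \<Longrightarrow> card (f a) \<le> c"
  shows "card (\<Union>(f ` A)) \<le> card A * c"
proof -
  have "card (\<Union>(f ` A)) \<le> (\<Sum>a\<in>A. card (f a))" using assms(1) by (rule card_UN_le)
  also have "\<dots> \<le> (\<Sum>a\<in>A. c)" using assms(2) by (rule sum_mono)
  finally show ?thesis by simp
qed

text \<open>A ball of radius \<open>k R\<close> contains at most \<open>(4 k + 1)\<^sup>2\<close> dominators: 25, 81 and 169 for
  \<open>k = 1, 2, 3\<close>. A dominator selects at most 169 nodes, each of which adds at most 81 more.\<close>
definition KH :: nat where "KH = 25 + 169 * (169 * 82)"

section \<open>Density and size of the backbone\<close>

locale sinr_net = sinr_model +
  fixes V :: "nat set" and pos :: "nat \<Rightarrow> pt" and I :: "nat set"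
  assumes finV: "finite V" and Vne: "V \<noteq> {}" and inj: "inj_on pos V"
    and conn: "connected_on (comm_adj M pos V) V" and mis: "is_mis (comm_adj M pos V) V I"
begin

abbreviation E where "E \<equiv> comm_adj M pos V"
abbreviation dst where "dst u v \<equiv> dist (pos u) (pos v)"

definition nb :: "nat \<Rightarrow> nat set" where "nb v = {w\<in>V. E w v}"

abbreviation X where "X \<equiv> ann nb I"

definition H :: "nat set" where
  "H = {v\<in>V. in_backbone v (v \<in> I) (knows nb I 5 v)}"

definition ldr :: "nat \<Rightarrow> nat" where "ldr v = leader v (v \<in> I) (knows nb I 5 v)"

lemma E_iff: "E u v \<longleftrightarrow> u \<in> V \<and> v \<in> V \<and> u \<noteq> v \<and> dst u v \<le> R"
  by (simp add: comm_adj_def R_def)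

lemma E_sym: "E u v \<longleftrightarrow> E v u"
  by (auto simp: E_iff dist_commute)

lemma nb_iff: "w \<in> nb v \<longleftrightarrow> E w v"
  by (auto simp: nb_def E_iff)

lemma nb_sym: "w \<in> nb v \<longleftrightarrow> v \<in> nb w"
  using E_sym by (simp add: nb_iff)

lemma nbD: "w \<in> nb v \<Longrightarrow> w \<in> V \<and> v \<in> V \<and> dst w v \<le> R"
  by (simp add: nb_iff E_iff)

lemma fin_nb: "finite (nb v)"
  using finV by (simp add: nb_def)

lemma I_sub: "I \<subseteq> V" using mis by (simp add: is_mis_def)

lemma I_sep: "i \<in> I \<Longrightarrow> j \<in> I \<Longrightarrow> i \<noteq> j \<Longrightarrow> dst i j > R"
  using mis I_sub unfolding is_mis_def by (metis E_iff not_le_imp_less subsetD)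

lemma fin_I_ball: "finite {i\<in>I. dist (pos i) z \<le> r}"
  using finV I_sub by (auto intro: finite_subset[of _ V])

lemma card_I_ball: "card {i\<in>I. dist (pos i) z \<le> real k * R} \<le> (4*k+1)^2"
  using card_separated_le[OF R_pos, of I pos z k] I_sep by blast

lemma card_subset_I_ball:
  assumes "S \<subseteq> {i\<in>I. dist (pos i) z \<le> real k * R}"
  shows "finite S \<and> card S \<le> (4*k+1)^2"
  using assms card_I_ball[of z k] card_mono[OF fin_I_ball assms] finite_subset[OF assms fin_I_ball] by simp

lemma X1_iff: "i \<in> X (Suc 0) v \<longleftrightarrow> i \<in> I \<and> (i = v \<or> i \<in> nb v)"
  unfolding ann_1 by (auto simp: ann_0 split: if_splits)

lemma X2_iff: "i \<in> X 2 v \<longleftrightarrow> (\<exists>b\<in>nb v. i \<in> X (Suc 0) b)"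
  unfolding ann_2 by blast

lemma X1_dist: "i \<in> X (Suc 0) v \<Longrightarrow> v \<in> V \<Longrightarrow> i \<in> I \<and> dst i v \<le> R"
  using R_pos by (auto simp: X1_iff dest: nbD)

lemma X2_dist: "i \<in> X 2 v \<Longrightarrow> i \<in> I \<and> dst i v \<le> 2 * R"
proof -
  assume "i \<in> X 2 v"
  then obtain b where "b \<in> nb v" "i \<in> X (Suc 0) b" by (auto simp: X2_iff)
  then show ?thesis using X1_dist[of i b] nbD[of b v] dist_triangle[of "pos i" "pos v" "pos b"] by auto
qed

lemma X1_nonempty: "v \<in> V \<Longrightarrow> X (Suc 0) v \<noteq> {}"
proof -
  assume v: "v \<in> V"
  have "\<exists>i. i \<in> X (Suc 0) v"
  proof (cases "v \<in> I")
    case False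
    then obtain i where "i \<in> I" "E v i" using mis v unfolding is_mis_def by blast
    then show ?thesis using E_sym by (auto simp: X1_iff nb_iff)
  qed (auto simp: X1_iff)
  then show ?thesis by blast
qed

lemma fin_X1: "v \<in> V \<Longrightarrow> finite (X (Suc 0) v)"
  by (rule finite_subset[OF _ fin_I_ball[of "pos v" R]]) (auto dest: X1_dist)

lemma X3E:
  assumes "a \<in> X 3 u"
  obtains w where "u \<in> I" "a \<in> insert u (nb u)" "w \<in> X 2 a"
    "a = Min {a \<in> insert u (nb u). w \<in> X 2 a}" "\<exists>a' \<in> insert u (nb u). w \<in> X 2 a'"
proof -
  have u: "u \<in> I" using assms by (auto simp: ann_3 split: if_splits)
  then obtain w where w: "a = Min {a \<in> insert u (nb u). w \<in> X 2 a}" "w \<in> \<Union>(X 2 ` insert u (nb u))"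
    using assms unfolding ann_3 by auto
  have "a \<in> {a \<in> insert u (nb u). w \<in> X 2 a}" unfolding w(1)
    using w(2) fin_nb by (intro Min_in) auto
  then show thesis using that[OF u _ _ w(1)] w(2) by blast
qed

lemma X3_V: "a \<in> X 3 u \<Longrightarrow> a \<in> V \<and> u \<in> I \<and> dst a u \<le> R"
  using I_sub R_pos by (elim X3E) (auto dest: nbD)

text \<open>The target dominators lie within \<open>3 * R\<close> of \<open>u\<close>, and the
  selection maps the targets onto the selected nodes.\<close>

lemma card_X3: "finite (X 3 u) \<and> card (X 3 u) \<le> 169"
proof (cases "u \<in> I")
  case True
  have "\<Union>(X 2 ` insert u (nb u)) \<subseteq> {i\<in>I. dst i u \<le> real 3 * R}"
  proof
    fix w assume "w \<in> \<Union>(X 2 ` insert u (nb u))"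
    then obtain a where a: "a = u \<or> a \<in> nb u" "w \<in> X 2 a" by blast
    then have "dst a u \<le> R" using nbD R_pos by auto
    then show "w \<in> {i\<in>I. dst i u \<le> real 3 * R}"
      using X2_dist[OF a(2)] dist_triangle[of "pos w" "pos u" "pos a"] by auto
  qed
  from card_subset_I_ball[OF this]
  have "finite (\<Union>(X 2 ` insert u (nb u)))" "card (\<Union>(X 2 ` insert u (nb u))) \<le> 169" by simp_all
  then show ?thesis unfolding ann_3 if_P[OF True]
    by (intro conjI finite_imageI order_trans[OF card_image_le])
qed (simp add: ann_3)

lemma card_X2: "finite (X 2 v) \<and> card (X 2 v) \<le> 81"
proof -
  have "X 2 v \<subseteq> {i\<in>I. dst i v \<le> real 2 * R}" using X2_dist by auto
  from card_subset_I_ball[OF this] show ?thesis by simp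
qed

lemma card_X4: "finite (X 4 v) \<and> card (X 4 v) \<le> 81"
  using card_X2[of v] card_image_le[of "X 2 v"] order_trans unfolding ann_4
  by (cases "v \<in> \<Union>(X 3 ` insert v (nb v))") (simp_all del: UN_insert, blast)

lemma X4E:
  assumes "c \<in> X 4 a"
  obtains u where "u \<in> insert a (nb a)" "a \<in> X 3 u" "c \<in> nb a"
proof -
  obtain u where u: "u \<in> insert a (nb a)" "a \<in> X 3 u" using assms by (auto simp: ann_4 split: if_splits)
  obtain w where w: "c = Min {c \<in> nb a. w \<in> X (Suc 0) c}" "w \<in> X 2 a"
    using assms by (auto simp: ann_4 split: if_splits)
  have "c \<in> {c \<in> nb a. w \<in> X (Suc 0) c}" unfolding w(1) using w(2) fin_nb by (intro Min_in) (auto simp: X2_iff)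
  then show thesis using that u by blast
qed

text \<open>The uniform bounds that let an announcement fit into one message and be decoded.\<close>

lemma ann_V: "v \<in> V \<Longrightarrow> finite (X k v) \<and> card (X k v) \<le> 169 \<and> X k v \<subseteq> V"
proof -
  assume v: "v \<in> V"
  consider "k = 0" | "k = 1" | "k = 2" | "k = 3" | "k = 4" | "k \<ge> 5" by linarith
  then show ?thesis
  proof cases
    case 1 then show ?thesis using v by (simp add: ann_0)
  next
    case 2
    have "X (Suc 0) v \<subseteq> {i\<in>I. dst i v \<le> real 1 * R}" using X1_dist v by auto
    from card_subset_I_ball[OF this] have "card (X (Suc 0) v) \<le> 25" by simp
    then show ?thesis using 2 fin_X1[OF v] I_sub by (auto simp: X1_iff)
  next
    case 3 then show ?thesis using card_X2[of v] X2_dist I_sub by auto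
  next
    case 4 then show ?thesis using card_X3[of v] X3_V by auto
  next
    case 5 then show ?thesis using card_X4[of v] by (auto elim!: X4E dest: nbD)
  qed (simp add: ann_ge5)
qed

lemma H_iff: "v \<in> H \<longleftrightarrow> v \<in> V \<and> (v \<in> I \<or> (\<exists>u\<in>insert v (nb v). v \<in> X 3 u) \<or> (\<exists>u\<in>nb v. v \<in> X 4 u))"
  unfolding H_def by (simp add: in_backbone_knows)

lemma I_sub_H: "I \<subseteq> H" using I_sub by (auto simp: H_iff)

lemma H_sub: "H \<subseteq> V" by (auto simp: H_iff)

lemma fin_H: "finite H" using H_sub finV finite_subset by blast

text \<open>Charges every node of \<open>H\<close> outside \<open>I\<close> to a dominator, which
  reduces density and size to counting dominators.\<close>

lemma H_cover: "H \<subseteq> I \<union> (\<Union>u\<in>I. \<Union>a\<in>X 3 u. insert a (X 4 a))"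
proof
  fix v assume v: "v \<in> H"
  have *: "a \<in> X 3 u \<Longrightarrow> u \<in> I" for a u using X3_V by blast
  show "v \<in> I \<union> (\<Union>u\<in>I. \<Union>a\<in>X 3 u. insert a (X 4 a))"
  proof -
    consider "v \<in> I" | u where "v \<in> X 3 u" | a where "v \<in> X 4 a" using v unfolding H_iff by blast
    then show ?thesis
    proof cases
      case 3
      then obtain u where "a \<in> X 3 u" by (elim X4E)
      then show ?thesis using 3 *[of a u] by blast
    qed (use * in blast)+
  qed
qed

lemma card_connectors: "card (\<Union>a\<in>X 3 u. insert a (X 4 a)) \<le> 169 * 82"
proof -
  have "card (insert a (X 4 a)) \<le> 82" for a
    using card_X4[of a] card_insert_le_m1[of 82 "X 4 a" a] by simp
  then have "card (\<Union>a\<in>X 3 u. insert a (X 4 a)) \<le> card (X 3 u) * 82"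
    using card_X3[of u] by (intro card_UN_le_mult) auto
  also have "\<dots> \<le> 169 * 82" using card_X3[of u] by simp
  finally show ?thesis .
qed

lemma fin_connectors: "finite (\<Union>a\<in>X 3 u. insert a (X 4 a))"
  by (intro finite_UN_I finite.insertI) (simp_all add: card_X3 card_X4)

text \<open>A connector is at most \<open>R\<close> from a selected node, which is at most
  \<open>R\<close> from its dominator; so near \<open>z\<close> only dominators within
  \<open>3 * R\<close> matter.\<close>

lemma H_density: "card {v\<in>H. dst v z \<le> R} \<le> KH"
proof -
  let ?C = "\<lambda>u. \<Union>a\<in>X 3 u. insert a (X 4 a)"
  let ?B1 = "{i\<in>I. dst i z \<le> real 1 * R}" and ?B3 = "{i\<in>I. dst i z \<le> real 3 * R}"
  have "{v\<in>H. dst v z \<le> R} \<subseteq> ?B1 \<union> (\<Union>u\<in>?B3. ?C u)"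
  proof
    fix v assume v: "v \<in> {v\<in>H. dst v z \<le> R}"
    show "v \<in> ?B1 \<union> (\<Union>u\<in>?B3. ?C u)"
    proof (cases "v \<in> I")
      case False
      then obtain u a where ua: "u \<in> I" "a \<in> X 3 u" "v = a \<or> v \<in> X 4 a" using v H_cover by blast
      have au: "dst a u \<le> R" using X3_V[OF ua(2)] by simp
      have "dst v a \<le> R" using ua(3) R_pos by (auto elim!: X4E dest: nbD)
      then have "dst u z \<le> real 3 * R"
        using au v dist_triangle[of "pos u" "pos z" "pos a"] dist_triangle[of "pos a" "pos z" "pos v"]
        by (simp add: dist_commute)
      then show ?thesis using ua by blast
    qed (use v in auto)
  qed
  then have "card {v\<in>H. dst v z \<le> R} \<le> card (?B1 \<union> (\<Union>u\<in>?B3. ?C u))"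
    using fin_I_ball fin_connectors by (intro card_mono) auto
  also have "\<dots> \<le> card ?B1 + card (\<Union>u\<in>?B3. ?C u)" by (rule card_Un_le)
  also have "\<dots> \<le> 25 + card ?B3 * (169 * 82)"
    using card_I_ball[of "pos z" 1] card_UN_le_mult[of ?B3 ?C "169 * 82"] fin_I_ball card_connectors
    by (intro add_mono) auto
  also have "\<dots> \<le> KH" using card_I_ball[of "pos z" 3] by (simp add: KH_def)
  finally show ?thesis .
qed

lemma I_density: "card {v\<in>I. dst v z \<le> R} \<le> KH"
proof -
  have "card {v\<in>I. dst v z \<le> R} \<le> card {v\<in>H. dst v z \<le> R}"
    using I_sub_H fin_H by (intro card_mono) auto
  then show ?thesis using H_density[of z] by (rule order_trans)
qed

text \<open>Every dominator lies within \<open>R\<close> of some node of a minimum connected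
  dominating set, and at most 25 dominators are that close to one node.\<close>

lemma card_I_le_min_cds: "card I \<le> min_cds_size E V * 25"
proof -
  let ?C = "{S. is_cds E V S}"
  have "finite ?C" by (rule finite_subset[of _ "Pow V"]) (use finV in \<open>auto simp: is_cds_def\<close>)
  \<comment> \<open>\<open>V\<close> is itself a candidate, so the minimum is attained.\<close>
  moreover have "V \<in> ?C" using Vne conn by (auto simp: is_cds_def dominating_def)
  ultimately have "min_cds_size E V \<in> card ` ?C"
    unfolding min_cds_size_def by (intro Min_in) auto
  then obtain S where S: "is_cds E V S" "min_cds_size E V = card S" by auto
  have finS: "finite S" using S(1) finV finite_subset by (auto simp: is_cds_def)
  have "I \<subseteq> (\<Union>s\<in>S. {i\<in>I. dst i s \<le> real 1 * R})"
  proof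
    fix i assume i: "i \<in> I"
    then have "i \<in> S \<or> (\<exists>s\<in>S. E i s)" using S(1) I_sub by (auto simp: is_cds_def dominating_def)
    then show "i \<in> (\<Union>s\<in>S. {i\<in>I. dst i s \<le> real 1 * R})"
      using i R_pos by (fastforce simp: E_iff)
  qed
  then have "card I \<le> card (\<Union>s\<in>S. {i\<in>I. dst i s \<le> real 1 * R})"
    using finS fin_I_ball by (intro card_mono) auto
  also have "\<dots> \<le> card S * 25"
    using finS card_I_ball[of _ 1] by (intro card_UN_le_mult) auto
  finally show ?thesis using S by simp
qed

lemma card_H_le: "card H \<le> KH * min_cds_size E V"
proof -
  have finI: "finite I" using I_sub finV finite_subset by blast
  have "card H \<le> card (I \<union> (\<Union>u\<in>I. \<Union>a\<in>X 3 u. insert a (X 4 a)))"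
    using finI fin_connectors by (intro card_mono H_cover) auto
  also have "\<dots> \<le> card I + card (\<Union>u\<in>I. \<Union>a\<in>X 3 u. insert a (X 4 a))" by (rule card_Un_le)
  also have "\<dots> \<le> card I + card I * (169 * 82)"
    using finI card_connectors by (intro add_left_mono card_UN_le_mult)
  \<comment> \<open>Here \<open>25 * (1 + 169 * 82) \<le> KH\<close>.\<close>
  also have "\<dots> \<le> KH * min_cds_size E V"
    using card_I_le_min_cds by (simp add: KH_def)
  finally show ?thesis .
qed

text \<open>For the edge \<open>ab\<close> witnessing a short path between the dominators \<open>u\<close> and \<open>w\<close>, the rules put some
  edge with the same property into \<open>H\<close>.\<close>
lemma reach_dominators:
  assumes ab: "a \<in> nb b" and u: "u \<in> X (Suc 0) a" and w: "w \<in> X (Suc 0) b"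
  shows "reach E H 3 u w"
proof -
  have uI: "u \<in> I" and wI: "w \<in> I" using u w by (auto simp: X1_iff)
  have "a \<in> insert u (nb u)" using u nb_sym by (auto simp: X1_iff)
  moreover have w2: "w \<in> X 2 a" using ab w nb_sym by (auto simp: X2_iff)
  ultimately have a': "a \<in> {a \<in> insert u (nb u). w \<in> X 2 a}" by simp
  define a0 where "a0 = Min {a \<in> insert u (nb u). w \<in> X 2 a}"
  have a0: "a0 \<in> insert u (nb u)" "w \<in> X 2 a0"
    using Min_in[of "{a \<in> insert u (nb u). w \<in> X 2 a}"] a' fin_nb unfolding a0_def by auto
  have a0X: "a0 \<in> X 3 u" unfolding ann_3 using uI a' by (auto simp: a0_def)
  have ua0: "u \<in> insert a0 (nb a0)" using a0 nb_sym by blast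
  have a0H: "a0 \<in> H" using a0X ua0 X3_V by (auto simp: H_iff)
  define b0 where "b0 = Min {c \<in> nb a0. w \<in> X (Suc 0) c}"
  have b0: "b0 \<in> nb a0" "w \<in> X (Suc 0) b0"
    using Min_in[of "{c \<in> nb a0. w \<in> X (Suc 0) c}"] a0(2) fin_nb unfolding b0_def by (auto simp: X2_iff)
  have "b0 \<in> X 4 a0" unfolding ann_4 using a0X ua0 a0(2) by (auto simp: b0_def)
  then have b0H: "b0 \<in> H" using b0(1) nb_sym nbD by (auto simp: H_iff)
  \<comment> \<open>\<open>u\<close> and \<open>a0\<close>, or \<open>b0\<close> and
    \<open>w\<close>, may coincide; \<open>reach\<close> with bound 1 covers both cases.\<close>
  have "reach E H 1 u a0" using ua0 I_sub_H uI a0H by (intro reach_edge) (auto simp: nb_iff)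
  moreover have "reach E H 1 a0 b0" using b0(1) nb_sym a0H b0H by (intro reach_edge) (auto simp: nb_iff)
  moreover have "reach E H 1 b0 w" using b0(2) nb_sym wI I_sub_H b0H
    by (intro reach_edge) (auto simp: X1_iff nb_iff)
  ultimately have "reach E H (1 + 1 + 1) u w" using reach_trans by blast
  then show ?thesis by (simp add: numeral_3_eq_3)
qed

text \<open>Every node of the path is replaced by a dominator in its closed neighbourhood;
  consecutive dominators are at most three steps apart in \<open>H\<close>.\<close>

lemma reach_along_path:
  assumes "(induced E V ^^ k) x y" "u \<in> X (Suc 0) x"
  shows "\<exists>w\<in>X (Suc 0) y. reach E H (3 * k) u w"
  using assms
proof (induction k arbitrary: y)
  case 0
  then show ?case by (auto intro: reach_refl)
next
  case (Suc k)
  then obtain z where z: "(induced E V ^^ k) x z" "induced E V z y" by auto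
  then obtain w where w: "w \<in> X (Suc 0) z" "reach E H (3 * k) u w" using Suc by blast
  have zy: "z \<in> nb y" "y \<in> V" using z(2) by (auto simp: induced_def nb_iff)
  obtain w' where w': "w' \<in> X (Suc 0) y" using X1_nonempty[OF zy(2)] by blast
  have "reach E H (3 * k + 3) u w'" using reach_trans[OF w(2) reach_dominators[OF zy(1) w(1) w']] .
  then show ?case using w' by (auto simp: add.commute)
qed

text \<open>Reaching a dominator and leaving the last one cost one step each, and
  \<open>1 + 3 * k + 1 \<le> 5 * k\<close> for \<open>k \<ge> 1\<close>; at \<open>k = 0\<close> the
  end points coincide.\<close>

lemma reach_H:
  assumes "x \<in> H" "y \<in> H"
  shows "reach E H (5 * hop_dist E V x y) x y"
proof -
  let ?k = "hop_dist E V x y"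
  have V: "x \<in> V" "y \<in> V" using assms H_sub by auto
  have k: "(induced E V ^^ ?k) x y" using conn V by (intro hop_dist_relpow) (simp add: connected_on_def)
  show ?thesis
  proof (cases "?k = 0")
    case True
    then show ?thesis using k by (simp add: reach_refl)
  next
    case False
    obtain u where u: "u \<in> X (Suc 0) x" using X1_nonempty V by blast
    obtain w where w: "w \<in> X (Suc 0) y" "reach E H (3 * ?k) u w" using reach_along_path[OF k u] by blast
    have "reach E H 1 x u" using u assms I_sub_H nb_sym by (intro reach_edge) (auto simp: X1_iff nb_iff)
    moreover have "reach E H 1 w y" using w(1) assms I_sub_H by (intro reach_edge) (auto simp: X1_iff nb_iff)
    ultimately have "reach E H (1 + 3 * ?k + 1) x y" using w(2) reach_trans by blast
    then show ?thesis by (rule reach_mono) (use False in linarith)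
  qed
qed

section \<open>The backbone properties and the two protocols\<close>

lemma ldr_props: "x \<in> V - H \<Longrightarrow> ldr x \<in> I \<and> E x (ldr x)"
proof -
  assume x: "x \<in> V - H"
  have "ldr x \<in> X (Suc 0) x" unfolding ldr_def leader_knows using x fin_X1 X1_nonempty by (intro Min_in) auto
  then show ?thesis using x I_sub_H E_sym by (auto simp: X1_iff nb_iff)
qed

lemma H_cds: "is_cds E V H"
proof -
  obtain v where "v \<in> V" using Vne by blast
  then have "H \<noteq> {}" using X1_nonempty I_sub_H by (fastforce simp: X1_iff)
  moreover have "connected_on E H"
    unfolding connected_on_def using reach_H reach_imp_rtranclp by blast
  moreover have "dominating E V H" unfolding dominating_def
    using ldr_props I_sub_H by blast
  ultimately show ?thesis using H_sub by (simp add: is_cds_def)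
qed

lemma H_diameter: "diameter E H \<le> 5 * diameter E V"
proof (rule diameter_le[OF fin_H])
  show "H \<noteq> {}" using H_cds by (simp add: is_cds_def)
  fix u v assume uv: "u \<in> H" "v \<in> H"
  have "hop_dist E H u v \<le> 5 * hop_dist E V u v" using reach_H[OF uv] by (rule hop_dist_le)
  also have "\<dots> \<le> 5 * diameter E V" using uv H_sub hop_dist_le_diameter[OF finV, of u v E] by auto
  finally show "hop_dist E H u v \<le> 5 * diameter E V" .
qed

text \<open>In the second half of \<open>Inter\<close> only dominators transmit; since leaders are dominators and
  dominators are pairwise out of range, leaders receive nothing that would have to be forwarded.\<close>
lemma backbone_okI:
  assumes out: "\<And>v. v \<in> V \<Longrightarrow> out v = (v \<in> H, ldr v, inter_sched v, intra_sched v)"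
    and P1: "\<And>i u v. u \<in> H \<Longrightarrow> v \<in> H \<Longrightarrow> E u v \<Longrightarrow> \<exists>i<h. sinr_rec M pos V {v\<in>H. i \<in> inter_sched v} v u"
    and P1_half: "\<And>i v. v \<in> V \<Longrightarrow> i \<in> inter_sched v \<Longrightarrow> h \<le> i \<Longrightarrow> v \<in> I"
    and P1_H: "\<And>i v. v \<in> V \<Longrightarrow> i \<in> inter_sched v \<Longrightarrow> v \<in> H"
    and P1': "\<And>u v. u \<in> I \<Longrightarrow> v \<in> V \<Longrightarrow> E u v \<Longrightarrow> \<exists>i\<ge>h. i < a1 \<and> sinr_rec M pos V {v\<in>I. i \<in> inter_sched v} u v"
    and P2: "\<And>u v. u \<in> V \<Longrightarrow> v \<in> V \<Longrightarrow> E u v \<Longrightarrow> \<exists>i<a2. sinr_rec M pos V {v\<in>V. i \<in> intra_sched v} u v"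
    and h: "h \<le> a1"
  shows "backbone_ok M pos V (real KH) a1 a2 out"
proof -
  have HH: "{v\<in>V. fst (out v)} = H" using out H_sub by auto
  have S1: "{v\<in>V. i \<in> fst (snd (snd (out v)))} = {v\<in>H. i \<in> inter_sched v}" for i
    using out P1_H H_sub by auto
  have S2: "{v\<in>V. i \<in> snd (snd (snd (out v)))} = {v\<in>V. i \<in> intra_sched v}" for i
    using out by auto
  have S1': "{v\<in>H. i \<in> inter_sched v} = {v\<in>I. i \<in> inter_sched v}" if "h \<le> i" for i
    using P1_half[OF _ _ that] H_sub I_sub_H by auto
  have ld: "fst (snd (out x)) = ldr x" if "x \<in> V" for x using out[OF that] by simp
  have c1: "real (diameter E H) \<le> real KH * real (diameter E V)"
  proof -
    have "diameter E H \<le> KH * diameter E V"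
      using H_diameter by (rule order_trans) (simp add: KH_def)
    then show ?thesis by (simp flip: of_nat_mult)
  qed
  have c2: "real (card {v\<in>H. E u v}) \<le> real KH" if "u \<in> V" for u
  proof -
    have "card {v\<in>H. E u v} \<le> card {v\<in>H. dst v u \<le> R}"
      using fin_H by (intro card_mono) (auto simp: E_iff dist_commute)
    then show ?thesis using H_density[of u] by linarith
  qed
  have c3: "real (card H) \<le> real KH * real (min_cds_size E V)"
    using card_H_le by (simp flip: of_nat_mult)
  have c4: "ldr x \<in> H \<and> E x (ldr x)" if "x \<in> V - H" for x using ldr_props[OF that] I_sub_H by blast
  have c5: "\<exists>i<a1. sinr_rec M pos V {v\<in>H. i \<in> inter_sched v} v u" if "u \<in> H" "v \<in> H" "E u v" for u v
    using P1[OF that] h by (meson order_less_le_trans)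
  have c6: "\<exists>j. i < j \<and> j < a1 \<and> sinr_rec M pos V {v\<in>H. j \<in> inter_sched v} (ldr x) x"
    if x: "x \<in> V - H" and i: "sinr_rec M pos V {v\<in>H. i \<in> inter_sched v} w (ldr x)" for x i w
  proof -
    have lI: "ldr x \<in> I" and lE: "E x (ldr x)" using ldr_props[OF x] by auto
    have ih: "i < h"
    proof (rule ccontr)
      assume "\<not> i < h"
      then have "sinr_rec M pos V {v\<in>I. i \<in> inter_sched v} w (ldr x)" using i S1'[of i] by simp
      then have "w \<in> I" "w \<noteq> ldr x" "dst w (ldr x) \<le> R" by (auto simp: sinr_rec_def R_def)
      then show False using I_sep[of w "ldr x"] lI by simp
    qed
    obtain j where "h \<le> j" "j < a1" "sinr_rec M pos V {v\<in>I. j \<in> inter_sched v} (ldr x) x"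
      using P1'[OF lI, of x] x lE E_sym by blast
    then show ?thesis using ih S1'[of j] by (intro exI[of _ j]) auto
  qed
  have c7: "\<exists>i<a2. sinr_rec M pos V {v\<in>V. i \<in> intra_sched v} x (ldr x)" if "x \<in> V - H" for x
    using that ldr_props[OF that] I_sub by (intro P2) auto
  show ?thesis unfolding backbone_ok_def Let_def HH S1 S2
    using H_cds c1 c2 c3 c4 c5 c6 c7 by (auto simp: ld)
qed

end

subsection \<open>Encoding announcements as bounded messages\<close>

fun digits_val :: "nat \<Rightarrow> nat list \<Rightarrow> nat" where
  "digits_val B [] = 0"
| "digits_val B (x # xs) = x + B * digits_val B xs"

text \<open>Positions past the end read as 0, which allows decoding without knowing the
  length.\<close>

lemma digits_val_nth:
  assumes "B > 1" "\<forall>x\<in>set xs. x < B"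
  shows "digits_val B xs div B ^ i mod B = (if i < length xs then xs ! i else 0)"
  using assms(2)
proof (induction xs arbitrary: i)
  case (Cons x xs)
  show ?case
  proof (cases i)
    case (Suc j)
    have "digits_val B (x # xs) div B ^ Suc j = (x + B * digits_val B xs) div B div B ^ j"
      by (simp add: div_mult2_eq)
    also have "(x + B * digits_val B xs) div B = digits_val B xs" using Cons.prems assms(1) by simp
    finally show ?thesis using Cons Suc by simp
  qed (use Cons.prems in simp)
qed simp

lemma digits_val_less: "\<forall>x\<in>set xs. x < B \<Longrightarrow> digits_val B xs < B ^ length xs"
proof (induction xs)
  case (Cons x xs)
  then have "x < B" "Suc (digits_val B xs) \<le> B ^ length xs" by auto
  then have "x + B * digits_val B xs < B * Suc (digits_val B xs)" by simp
  also have "\<dots> \<le> B * B ^ length xs" using Cons by (intro mult_left_mono) auto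
  finally show ?case by simp
qed simp

text \<open>The sender's name is digit 0; the base is \<open>N + 1\<close> since names reach
  \<open>N\<close>.\<close>

definition code :: "nat \<Rightarrow> nat \<Rightarrow> nat set \<Rightarrow> nat" where
  "code N v X = digits_val (N + 1) (v # sorted_list_of_set X)"

text \<open>Names are positive, so the digit \<open>0\<close> only occurs as padding.\<close>
definition decode :: "nat \<Rightarrow> nat \<Rightarrow> nat \<times> nat set" where
  "decode N m = (m mod (N + 1), (\<lambda>i. m div (N + 1) ^ i mod (N + 1)) ` {1..} - {0})"

lemma decode_code:
  assumes "N \<ge> 1" "v \<le> N" "X \<subseteq> {1..N}"
  shows "decode N (code N v X) = (v, X)"
proof -
  have fin: "finite X" using assms(3) finite_subset by blast
  let ?l = "v # sorted_list_of_set X"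
  have "\<forall>x\<in>set ?l. x < N + 1" using assms fin by auto
  then have dig: "code N v X div (N + 1) ^ i mod (N + 1) = (if i < length ?l then ?l ! i else 0)" for i
    unfolding code_def using assms(1) by (intro digits_val_nth) auto
  have mem: "?l ! Suc j \<in> X" if "j < length (sorted_list_of_set X)" for j
    using nth_mem[OF that] fin by simp
  have "(\<lambda>i. code N v X div (N + 1) ^ i mod (N + 1)) ` {1..} - {0} = X"
  proof (intro equalityI subsetI)
    fix x assume "x \<in> (\<lambda>i. code N v X div (N + 1) ^ i mod (N + 1)) ` {1..} - {0}"
    then obtain i where i: "i \<ge> 1" "x = (if i < length ?l then ?l ! i else 0)" "x \<noteq> 0"
      unfolding dig by blast
    then obtain j where "i = Suc j" by (cases i) auto
    then show "x \<in> X" using i mem[of j] by (auto split: if_splits)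
  next
    fix x assume x: "x \<in> X"
    then obtain j where j: "j < length (sorted_list_of_set X)" "x = sorted_list_of_set X ! j"
      using fin by (metis in_set_conv_nth set_sorted_list_of_set)
    have "x \<in> (\<lambda>i. code N v X div (N + 1) ^ i mod (N + 1)) ` {1..}"
    proof (rule image_eqI)
      show "x = code N v X div (N + 1) ^ Suc j mod (N + 1)" unfolding dig using j by simp
    qed simp
    moreover have "x \<noteq> 0" using x assms(3) by auto
    ultimately show "x \<in> (\<lambda>i. code N v X div (N + 1) ^ i mod (N + 1)) ` {1..} - {0}" by simp
  qed
  then show ?thesis using dig[of 0] by (simp add: decode_def)
qed

text \<open>There are at most \<open>k + 1\<close> digits, and \<open>N + 1 \<le> N ^ 2\<close> for
  \<open>N \<ge> 2\<close>. With \<open>k = 169\<close> this yields the message bound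
  \<open>N ^ 340\<close>, that is, \<open>O(log N)\<close> bits.\<close>

lemma code_less:
  assumes "N \<ge> 2" "v \<le> N" "X \<subseteq> {1..N}" "card X \<le> k"
  shows "code N v X < N ^ (2 * (k + 1))"
proof -
  have fin: "finite X" using assms(3) finite_subset by blast
  have "code N v X < (N + 1) ^ length (v # sorted_list_of_set X)"
    unfolding code_def using assms fin by (intro digits_val_less) auto
  also have "\<dots> \<le> (N + 1) ^ (k + 1)"
    using assms(4) by (intro power_increasing) auto
  also have "\<dots> \<le> (N ^ 2) ^ (k + 1)"
  proof (rule power_mono)
    have "2 * N \<le> N * N" using assms(1) by simp
    then show "N + 1 \<le> N ^ 2" using assms(1) unfolding power2_eq_square by linarith
  qed simp
  finally show ?thesis by (simp only: power_mult)
qed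

subsection \<open>The distributed algorithm\<close>

text \<open>A state is \<open>[name, N, \<Delta>, b, tape, 0]\<close> followed by one entry per round: \<open>0\<close> for silence and
  \<open>m + 1\<close> for a received message \<open>m\<close>. The tape, drawn in round \<open>0\<close>, is the set of rounds in which
  the node transmits.\<close>

definition heard :: "nat \<Rightarrow> nat list \<Rightarrow> nat \<Rightarrow> knowledge" where
  "heard L s k = (\<lambda>j. if j < k then {decode (s ! 1) m | m i. i div L = j \<and> i < length s - 6 \<and> s ! (6 + i) = Suc m} else {})"

text \<open>Length 4 identifies round \<open>0\<close>. That round appends the tape and, nothing
  being heard, the entry \<open>0\<close>; hence \<open>length s - 6\<close> counts the rounds after
  it. The tape covers five phases and the \<open>2 * h N\<close> rounds of
  \<open>Inter\<close>.\<close>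

definition node_act :: "(nat \<Rightarrow> nat \<Rightarrow> nat) \<Rightarrow> (nat \<Rightarrow> nat) \<Rightarrow> (nat \<Rightarrow> nat \<Rightarrow> nat \<Rightarrow> real)
    \<Rightarrow> nat list \<Rightarrow> (nat list \<times> nat option) pmf" where
  "node_act L h q s =
    (let v = s ! 0; N = s ! 1; D = s ! 2; b = (s ! 3 = 1); t = length s - 6; k = t div L N D in
     if length s = 4
     then map_pmf (\<lambda>\<tau>. (s @ [set_encode \<tau>], None)) (tape_pmf (q N D) (5 * L N D + 2 * h N))
     else return_pmf (s, if t \<in> set_decode (s ! 4)
            then Some (code N v (announce k v b (heard (L N D) s k))) else None))"

text \<open>\<open>Inter\<close> uses the last \<open>2 * h N\<close> tape positions: all of
  \<open>H\<close> in the first half, only dominators in the second. \<open>Intra\<close> replays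
  the first phase.\<close>

definition node_out :: "(nat \<Rightarrow> nat \<Rightarrow> nat) \<Rightarrow> (nat \<Rightarrow> nat) \<Rightarrow> nat list \<Rightarrow> bool \<times> nat \<times> nat set \<times> nat set" where
  "node_out L h s =
    (let v = s ! 0; N = s ! 1; D = s ! 2; b = (s ! 3 = 1); l = L N D;
         \<tau> = set_decode (s ! 4); R = heard l s 5
     in (in_backbone v b R, leader v b R,
         {i. i < 2 * h N \<and> 5 * l + i \<in> \<tau> \<and> (if i < h N then in_backbone v b R else b)},
         {i. i < l \<and> i \<in> \<tau>}))"

text \<open>The extra round is the one that draws the tapes; the \<open>Inter\<close> part of the
  tape is output, not executed.\<close>

definition connectBB :: "(nat \<Rightarrow> nat \<Rightarrow> nat) \<Rightarrow> (nat \<Rightarrow> nat) \<Rightarrow> (nat \<Rightarrow> nat \<Rightarrow> nat \<Rightarrow> real) \<Rightarrow> alg" where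
  "connectBB L h q =
    \<lparr>a_init = (\<lambda>v N D b. [v, N, D, of_bool b]),
     a_act = node_act L h q,
     a_recv = (\<lambda>s m. s @ [case m of None \<Rightarrow> 0 | Some x \<Rightarrow> Suc x]),
     a_out = node_out L h,
     a_rounds = (\<lambda>N D. Suc (5 * L N D))\<rparr>"

text \<open>The definition of \<open>run\<close> appends rounds at the end; peeling off the first
  one isolates the round that draws the tapes.\<close>

lemma run_Suc:
  "run M pos V B A c (Suc t) = bind_pmf (round_step M pos V B A c) (\<lambda>c'. run M pos V B A c' t)"
proof -
  let ?f = "\<lambda>p. bind_pmf p (round_step M pos V B A)"
  have gen: "(?f ^^ t) p = bind_pmf p (\<lambda>c'. run M pos V B A c' t)" for p
  proof (induction t)
    case 0 then show ?case by (simp add: run_def bind_return_pmf')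
  next
    case (Suc t) then show ?case by (simp add: run_def bind_assoc_pmf)
  qed
  show ?thesis
    by (simp only: run_def[of _ _ _ _ _ c] funpow_Suc_right o_apply bind_return_pmf gen)
qed

text \<open>Used with \<open>P\<close> the distribution of the tapes: once good tapes are drawn, the
  rest of the run is deterministic.\<close>

lemma prob_bind_ge:
  assumes "\<And>x. x \<in> G \<Longrightarrow> x \<in> set_pmf P \<Longrightarrow> \<exists>y\<in>A. f x = return_pmf y"
  shows "measure_pmf.prob (bind_pmf P f) A \<ge> measure_pmf.prob P G"
proof -
  have "emeasure (measure_pmf P) (G \<inter> set_pmf P) = (\<integral>\<^sup>+x. indicator (G \<inter> set_pmf P) x \<partial>measure_pmf P)" by simp
  also have "\<dots> \<le> (\<integral>\<^sup>+x. emeasure (measure_pmf (f x)) A \<partial>measure_pmf P)"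
  proof (rule nn_integral_mono)
    fix x show "indicator (G \<inter> set_pmf P) x \<le> emeasure (measure_pmf (f x)) A"
      using assms[of x] by (cases "x \<in> G \<inter> set_pmf P") (auto simp: indicator_def)
  qed
  also have "\<dots> = emeasure (measure_pmf (bind_pmf P f)) A" by simp
  finally have "measure_pmf.prob P (G \<inter> set_pmf P) \<le> measure_pmf.prob (bind_pmf P f) A"
    by (simp add: measure_pmf.emeasure_eq_measure)
  then show ?thesis by (simp add: measure_Int_set_pmf)
qed

section \<open>The execution as a function of the tapes\<close>

locale connectBB_run = sinr_net +
  fixes N D :: nat and L :: "nat \<Rightarrow> nat \<Rightarrow> nat" and h :: "nat \<Rightarrow> nat" and q :: "nat \<Rightarrow> nat \<Rightarrow> nat \<Rightarrow> real"
  assumes N: "N \<ge> 2" and VN: "V \<subseteq> {1..N}" and Lpos: "L N D > 0"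
begin

abbreviation l where "l \<equiv> L N D"
abbreviation A where "A \<equiv> connectBB L h q"
abbreviation tapes where "tapes \<equiv> Pi_pmf V {} (\<lambda>_. tape_pmf (q N D) (5 * l + 2 * h N))"

definition init where "init v = a_init A v N D (v \<in> I)"

abbreviation on :: "(nat \<Rightarrow> nat set) \<Rightarrow> nat \<Rightarrow> nat set" where "on \<tau> t \<equiv> {v\<in>V. t \<in> \<tau> v}"

text \<open>What a node records in round \<open>t\<close> if every transmitter sends its ideal
  announcement; \<open>run_cfg\<close> confirms this for good tapes.\<close>

definition entry :: "(nat \<Rightarrow> nat set) \<Rightarrow> nat \<Rightarrow> nat \<Rightarrow> nat" where
  "entry \<tau> t v = (if \<exists>w. sinr_rec M pos V (on \<tau> t) w v
     then Suc (let w = (SOME w. sinr_rec M pos V (on \<tau> t) w v) in code N w (X (t div l) w)) else 0)"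

definition cfg :: "(nat \<Rightarrow> nat set) \<Rightarrow> nat \<Rightarrow> nat \<Rightarrow> nat list" where
  "cfg \<tau> t v = (if v \<in> V
     then [v, N, D, of_bool (v \<in> I), set_encode (\<tau> v), 0] @ map (\<lambda>i. entry \<tau> i v) [0..<t]
     else init v)"

definition phases_ok :: "(nat \<Rightarrow> nat set) \<Rightarrow> bool" where
  "phases_ok \<tau> \<longleftrightarrow> (\<forall>k<5. \<forall>u v. E u v \<longrightarrow> (\<exists>i. i div l = k \<and> sinr_rec M pos V (on \<tau> i) u v))"

lemma entry_eq: "sinr_rec M pos V (on \<tau> t) w v \<Longrightarrow> entry \<tau> t v = Suc (code N w (X (t div l) w))"
proof -
  assume *: "sinr_rec M pos V (on \<tau> t) w v"
  then have "(SOME w. sinr_rec M pos V (on \<tau> t) w v) = w"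
    using sinr_rec_unique[OF finV] by (intro some_equality) auto
  then show ?thesis using * by (auto simp: entry_def)
qed

lemma decode_announcement: "w \<in> V \<Longrightarrow> decode N (code N w (X k w)) = (w, X k w)"
  using N VN ann_V[of w k] by (intro decode_code) auto

text \<open>Only neighbours can be received, and by \<open>phases_ok\<close> each of them is
  received in every phase; the rounds of the phases before \<open>k\<close> all precede
  \<open>t\<close>.\<close>

lemma heard_cfg:
  assumes \<tau>: "phases_ok \<tau>" and k: "k \<le> 5" and t: "k * l \<le> t" and v: "v \<in> V"
  shows "heard l (cfg \<tau> t v) k = knows nb I k v"
proof
  fix j
  show "heard l (cfg \<tau> t v) k j = knows nb I k v j"
  proof (cases "j < k")
    case True
    have nth: "cfg \<tau> t v ! (6 + i) = entry \<tau> i v" if "i < t" for i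
      using v that by (simp add: cfg_def nth_append)
    have len: "length (cfg \<tau> t v) - 6 = t" and N1: "cfg \<tau> t v ! 1 = N" using v by (simp_all add: cfg_def)
    have bnd: "i < t" if "i div l = j" for i
    proof -
      have "i < Suc j * l" using that Lpos by (metis dividend_less_div_times mult_Suc add.commute)
      also have "\<dots> \<le> k * l" using True by (intro mult_right_mono) auto
      finally show ?thesis using t by simp
    qed
    have "heard l (cfg \<tau> t v) k j = {decode N m | m i. i div l = j \<and> entry \<tau> i v = Suc m}"
    proof -
      have "i div l = j \<and> i < t \<and> cfg \<tau> t v ! (6 + i) = Suc m \<longleftrightarrow> i div l = j \<and> entry \<tau> i v = Suc m" for i m
        using nth bnd by metis
      then show ?thesis unfolding heard_def len N1 using True by simp
    qed
    also have "\<dots> = (\<lambda>w. (w, X j w)) ` nb v"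
    proof (intro equalityI subsetI)
      fix x assume "x \<in> {decode N m | m i. i div l = j \<and> entry \<tau> i v = Suc m}"
      then obtain m i where x: "x = decode N m" "i div l = j" "entry \<tau> i v = Suc m" by blast
      then obtain w where w: "sinr_rec M pos V (on \<tau> i) w v" by (auto simp: entry_def split: if_splits)
      then have m: "m = code N w (X j w)" using entry_eq[OF w] x by simp
      have wV: "w \<in> V" and "w \<in> nb v" using w v by (auto simp: sinr_rec_def nb_iff E_iff R_def)
      then show "x \<in> (\<lambda>w. (w, X j w)) ` nb v" using x m decode_announcement[OF wV] by auto
    next
      fix x assume "x \<in> (\<lambda>w. (w, X j w)) ` nb v"
      then obtain w where w: "w \<in> nb v" "x = (w, X j w)" by blast
      then obtain i where i: "i div l = j" "sinr_rec M pos V (on \<tau> i) w v"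
        using \<tau> True k unfolding phases_ok_def nb_iff by (meson less_le_trans)
      have "w \<in> V" using w nbD by blast
      then have "x = decode N (code N w (X j w))" using w decode_announcement by simp
      then show "x \<in> {decode N m | m i. i div l = j \<and> entry \<tau> i v = Suc m}"
        using entry_eq[OF i(2)] i(1) by blast
    qed
    finally show ?thesis using True by (simp add: knows_def)
  qed (simp add: heard_def knows_def)
qed

lemma node_act_cfg:
  assumes \<tau>: "phases_ok \<tau>" "finite (\<tau> v)" and t: "t < 5 * l" and v: "v \<in> V"
  shows "node_act L h q (cfg \<tau> t v)
    = return_pmf (cfg \<tau> t v, if t \<in> \<tau> v then Some (code N v (X (t div l) v)) else None)"
proof -
  let ?s = "cfg \<tau> t v" and ?k = "t div l"
  have s: "?s ! 0 = v" "?s ! 1 = N" "?s ! 2 = D" "?s ! 3 = of_bool (v \<in> I)" "?s ! 4 = set_encode (\<tau> v)"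
     "length ?s = t + 6" using v by (simp_all add: cfg_def)
  have "?k < 5" using t Lpos by (simp add: less_mult_imp_div_less mult.commute)
  moreover have "?k * l \<le> t" by (rule div_times_less_eq_dividend)
  ultimately have "heard l ?s ?k = knows nb I ?k v" using \<tau> v by (intro heard_cfg) auto
  then show ?thesis
    by (simp add: node_act_def s s(2)[simplified] Let_def \<tau> set_encode_inverse ann_eq_announce)
qed

text \<open>Given the tapes, all actions are deterministic, and the announcements are short enough
  to survive the reduction modulo the message bound.\<close>

lemma round_step_cfg:
  assumes \<tau>: "phases_ok \<tau>" "\<And>v. v \<in> V \<Longrightarrow> finite (\<tau> v)" and t: "t < 5 * l"
  shows "round_step M pos V (N ^ 340) A (cfg \<tau> t) = return_pmf (cfg \<tau> (Suc t))"
proof -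
  let ?acts = "\<lambda>v. if v \<in> V then (cfg \<tau> t v, if t \<in> \<tau> v then Some (code N v (X (t div l) v)) else None) else ([], None)"
  have acts: "Pi_pmf V ([], None) (\<lambda>v. a_act A (cfg \<tau> t v)) = return_pmf ?acts"
  proof -
    have "Pi_pmf V ([], None) (\<lambda>v. a_act A (cfg \<tau> t v)) = Pi_pmf V ([], None)
       (\<lambda>v. return_pmf (cfg \<tau> t v, if t \<in> \<tau> v then Some (code N v (X (t div l) v)) else None))"
      using \<tau> t by (intro Pi_pmf_cong refl) (simp add: connectBB_def node_act_cfg)
    then show ?thesis using finV by simp
  qed
  have T: "{v\<in>V. snd (?acts v) \<noteq> None} = on \<tau> t" by auto
  have "a_recv A (fst (?acts v)) (if \<exists>w. sinr_rec M pos V (on \<tau> t) w v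
      then Some (the (snd (?acts (SOME w. sinr_rec M pos V (on \<tau> t) w v))) mod N ^ 340) else None)
     = cfg \<tau> (Suc t) v" if v: "v \<in> V" for v
  proof (cases "\<exists>w. sinr_rec M pos V (on \<tau> t) w v")
    case True
    then obtain w where w: "sinr_rec M pos V (on \<tau> t) w v" by blast
    then have some: "(SOME w. sinr_rec M pos V (on \<tau> t) w v) = w"
      using sinr_rec_unique[OF finV] by (intro some_equality) auto
    have w': "w \<in> V" "t \<in> \<tau> w" using w by (auto simp: sinr_rec_def)
    have "code N w (X (t div l) w) < N ^ (2 * (169 + 1))"
      using N VN w' ann_V[OF w'(1), of "t div l"] by (intro code_less) auto
    then have "code N w (X (t div l) w) mod N ^ 340 = code N w (X (t div l) w)" by simp
    then show ?thesis using True v w' entry_eq[OF w] by (simp add: some connectBB_def cfg_def)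
  next
    case False
    then show ?thesis using v by (simp add: connectBB_def cfg_def entry_def)
  qed
  then have "(\<lambda>u. if u \<in> V then a_recv A (fst (?acts u)) (if \<exists>w. sinr_rec M pos V (on \<tau> t) w u
      then Some (the (snd (?acts (SOME w. sinr_rec M pos V (on \<tau> t) w u))) mod N ^ 340) else None) else cfg \<tau> t u)
     = cfg \<tau> (Suc t)" by (auto simp: cfg_def fun_eq_iff)
  then show ?thesis unfolding round_step_def acts Let_def map_return_pmf T by (simp only:)
qed

lemma run_cfg:
  assumes \<tau>: "phases_ok \<tau>" "\<And>v. v \<in> V \<Longrightarrow> finite (\<tau> v)" and t: "t + t' \<le> 5 * l"
  shows "run M pos V (N ^ 340) A (cfg \<tau> t') t = return_pmf (cfg \<tau> (t' + t))"
  using t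
proof (induction t arbitrary: t')
  case 0 then show ?case by (simp add: run_def)
next
  case (Suc t)
  then show ?case using \<tau> by (simp add: run_Suc round_step_cfg bind_return_pmf)
qed

text \<open>Nobody transmits in round \<open>0\<close>, so drawing the tapes is all that
  happens.\<close>

lemma round_step_init: "round_step M pos V B A init = map_pmf (\<lambda>\<tau>. cfg \<tau> 0) tapes"
proof -
  let ?act = "\<lambda>\<tau> v. (init v @ [set_encode (\<tau> v)], None :: nat option)"
  have "Pi_pmf V ([], None) (\<lambda>v. a_act A (init v))
     = Pi_pmf V ([], None) (\<lambda>v. bind_pmf (tape_pmf (q N D) (5 * l + 2 * h N)) (\<lambda>\<tau>v. return_pmf (init v @ [set_encode \<tau>v], None)))"
    by (intro Pi_pmf_cong refl) (simp add: connectBB_def node_act_def init_def map_pmf_def)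
  also have "\<dots> = bind_pmf tapes (\<lambda>\<tau>. Pi_pmf V ([], None) (\<lambda>v. return_pmf (?act \<tau> v)))"
    using finV by (rule Pi_pmf_bind)
  also have "\<dots> = map_pmf (\<lambda>\<tau> v. if v \<in> V then ?act \<tau> v else ([], None)) tapes"
    using finV by (simp add: map_pmf_def)
  finally have acts: "Pi_pmf V ([], None) (\<lambda>v. a_act A (init v))
     = map_pmf (\<lambda>\<tau> v. if v \<in> V then ?act \<tau> v else ([], None)) tapes" .
  have "{v\<in>V. snd (if v \<in> V then ?act \<tau> v else ([], None)) \<noteq> None} = {}" for \<tau> by auto
  moreover have "\<not> sinr_rec M pos V {} w u" for w u by (simp add: sinr_rec_def)
  ultimately show ?thesis
    unfolding round_step_def acts Let_def pmf.map_comp o_def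
    by (intro map_pmf_cong refl ext) (simp add: cfg_def connectBB_def init_def)
qed

text \<open>The transmitters are restricted to \<open>H\<close> and to \<open>I\<close> because all
  other nodes stay silent in the respective half of \<open>Inter\<close>, whatever their tapes
  say.\<close>

definition protocols_ok :: "(nat \<Rightarrow> nat set) \<Rightarrow> bool" where
  "protocols_ok \<tau> \<longleftrightarrow>
     (\<forall>u\<in>H. \<forall>v\<in>H. E u v \<longrightarrow> (\<exists>i\<in>{5*l..<5*l + h N}. sinr_rec M pos V {w\<in>H. i \<in> \<tau> w} u v)) \<and>
     (\<forall>u\<in>I. \<forall>v\<in>V. E u v \<longrightarrow> (\<exists>i\<in>{5*l + h N..<5*l + 2 * h N}. sinr_rec M pos V {w\<in>I. i \<in> \<tau> w} u v))"

lemma output_ok: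
  assumes \<tau>: "phases_ok \<tau>" "\<And>v. v \<in> V \<Longrightarrow> finite (\<tau> v)" and prot: "protocols_ok \<tau>"
  shows "backbone_ok M pos V (real KH) (2 * h N) l (\<lambda>v. a_out A (cfg \<tau> (5 * l) v))"
proof -
  let ?P1 = "\<lambda>v. {i. i < 2 * h N \<and> 5 * l + i \<in> \<tau> v \<and> (if i < h N then v \<in> H else v \<in> I)}"
  let ?P2 = "\<lambda>v. {i. i < l \<and> i \<in> \<tau> v}"
  show ?thesis
  proof (rule backbone_okI[where h = "h N" and inter_sched = ?P1 and intra_sched = ?P2])
    fix v assume v: "v \<in> V"
    have s: "cfg \<tau> (5*l) v ! 0 = v" "cfg \<tau> (5*l) v ! 1 = N" "cfg \<tau> (5*l) v ! 2 = D"
      "cfg \<tau> (5*l) v ! 3 = of_bool (v \<in> I)" "cfg \<tau> (5*l) v ! 4 = set_encode (\<tau> v)"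
      using v by (simp_all add: cfg_def)
    have b: "(of_bool (v \<in> I) = (1::nat)) \<longleftrightarrow> v \<in> I" by simp
    have k: "heard l (cfg \<tau> (5*l) v) 5 = knows nb I 5 v" using \<tau> v by (intro heard_cfg) auto
    have inH: "in_backbone v (v \<in> I) (knows nb I 5 v) \<longleftrightarrow> v \<in> H" using v by (simp add: H_def)
    show "a_out A (cfg \<tau> (5*l) v) = (v \<in> H, ldr v, ?P1 v, ?P2 v)"
      by (simp only: connectBB_def alg.simps node_out_def Let_def s b k set_encode_inverse[OF \<tau>(2)[OF v]]
          inH ldr_def[symmetric])
  next
    fix u v assume uv: "u \<in> H" "v \<in> H" "E u v"
    \<comment> \<open>\<open>backbone_okI\<close> names the receiver first,
      \<open>protocols_ok\<close> the sender; hence the reversed edge.\<close>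
    have "E v u" using uv(3) E_sym[of u v] by simp
    then obtain i where i: "i \<in> {5*l..<5*l + h N}" "sinr_rec M pos V {w\<in>H. i \<in> \<tau> w} v u"
      using prot uv unfolding protocols_ok_def by meson
    obtain j where j: "i = 5 * l + j" using i(1) le_Suc_ex[of "5 * l" i] by auto
    have "{w\<in>H. j \<in> ?P1 w} = {w\<in>H. i \<in> \<tau> w}" using i(1) j by auto
    then show "\<exists>j<h N. sinr_rec M pos V {w\<in>H. j \<in> ?P1 w} v u" using i j by auto
  next
    fix u v assume "u \<in> I" "v \<in> V" "E u v"
    then obtain i where i: "i \<in> {5*l + h N..<5*l + 2 * h N}" "sinr_rec M pos V {w\<in>I. i \<in> \<tau> w} u v"
      using prot unfolding protocols_ok_def by meson
    obtain j where j: "i = 5 * l + j" using i(1) le_Suc_ex[of "5 * l" i] by auto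
    have "{w\<in>I. j \<in> ?P1 w} = {w\<in>I. i \<in> \<tau> w}" using i(1) j by auto
    then show "\<exists>j\<ge>h N. j < 2 * h N \<and> sinr_rec M pos V {w\<in>I. j \<in> ?P1 w} u v"
      using i j by (intro exI[of _ j]) auto
  next
    fix u v assume "u \<in> V" "v \<in> V" "E u v"
    \<comment> \<open>Phase 0 doubles as the \<open>Intra\<close> schedule.\<close>
    then obtain i where i: "i div l = 0" "sinr_rec M pos V (on \<tau> i) u v"
      using \<tau>(1) unfolding phases_ok_def by (meson zero_less_numeral)
    have "i < l" using i(1) Lpos by (simp add: div_eq_0_iff)
    then have "{w\<in>V. i \<in> ?P2 w} = on \<tau> i" by auto
    then show "\<exists>i<l. sinr_rec M pos V {w\<in>V. i \<in> ?P2 w} u v" using i \<open>i < l\<close> by auto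
  qed (use I_sub_H in \<open>auto split: if_splits\<close>)
qed

lemma success_ge:
  "measure_pmf.prob (run M pos V (N ^ 340) A init (a_rounds A N D))
     {c. backbone_ok M pos V (real KH) (2 * h N) l (\<lambda>v. a_out A (c v))}
   \<ge> measure_pmf.prob tapes {\<tau>. phases_ok \<tau> \<and> protocols_ok \<tau>}"
proof -
  have "run M pos V (N ^ 340) A init (a_rounds A N D)
      = bind_pmf tapes (\<lambda>\<tau>. run M pos V (N ^ 340) A (cfg \<tau> 0) (5 * l))"
    by (simp add: connectBB_def run_Suc)
       (simp add: round_step_init[unfolded connectBB_def] bind_map_pmf)
  moreover have "measure_pmf.prob (bind_pmf tapes (\<lambda>\<tau>. run M pos V (N ^ 340) A (cfg \<tau> 0) (5 * l)))
     {c. backbone_ok M pos V (real KH) (2 * h N) l (\<lambda>v. a_out A (c v))}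
   \<ge> measure_pmf.prob tapes {\<tau>. phases_ok \<tau> \<and> protocols_ok \<tau>}"
  proof (rule prob_bind_ge)
    fix \<tau> assume \<tau>: "\<tau> \<in> {\<tau>. phases_ok \<tau> \<and> protocols_ok \<tau>}" "\<tau> \<in> set_pmf tapes"
    have fin: "finite (\<tau> v)" if "v \<in> V" for v
      using \<tau>(2) that finV tape_pmf_finite by (auto simp: set_Pi_pmf PiE_dflt_def)
    show "\<exists>c\<in>{c. backbone_ok M pos V (real KH) (2 * h N) l (\<lambda>v. a_out A (c v))}.
        run M pos V (N ^ 340) A (cfg \<tau> 0) (5 * l) = return_pmf c"
      using \<tau>(1) fin run_cfg[of \<tau> "5 * l" 0] output_ok[of \<tau>] by auto
  qed
  ultimately show ?thesis by simp
qed

end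

subsection \<open>Failure probability\<close>

text \<open>Follows from \<open>1 - x \<le> exp (- x)\<close>, and \<open>ln\<close> is at most
  \<open>log 2\<close> on numbers from 1 on because \<open>ln 2 < 1\<close>.\<close>

lemma one_minus_power_le_powr:
  fixes x e :: real
  assumes x: "0 \<le> x" "x \<le> 1" and N: "N \<ge> 2" and e: "e > 0" and n: "x * real n \<ge> e * log 2 (real N)"
  shows "(1 - x) ^ n \<le> real N powr (- e)"
proof -
  have "ln (real N) \<le> log 2 (real N)"
  proof -
    have "ln (real N) * ln 2 \<le> ln (real N) * 1" using N ln_2_less_1 by (intro mult_left_mono) auto
    then show ?thesis by (simp add: log_def field_simps)
  qed
  then have "e * ln (real N) \<le> x * real n" using n e by (meson mult_left_mono less_imp_le order_trans)
  moreover have "(1 - x) ^ n \<le> exp (- x) ^ n"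
    using x exp_ge_add_one_self[of "- x"] by (intro power_mono) auto
  moreover have "exp (- x) ^ n = exp (- (x * real n))"
    by (simp add: exp_of_nat_mult[symmetric] mult.commute)
  ultimately have "(1 - x) ^ n \<le> exp (- (e * ln (real N)))" by (smt (verit) exp_le_cancel_iff)
  then show ?thesis using N by (simp add: powr_def)
qed

text \<open>The ball contains at most \<open>z\<close> and its neighbours; this is the source of the
  density bound \<open>D + 1\<close>.\<close>

lemma card_ball_le_max_degree:
  assumes "finite V" "z \<in> V"
  shows "card {w\<in>V. dist (pos w) (pos z) \<le> (1 - eps M) * rng M} \<le> max_degree (comm_adj M pos V) V + 1"
proof -
  let ?E = "comm_adj M pos V"
  have "{w\<in>V. dist (pos w) (pos z) \<le> (1 - eps M) * rng M} \<subseteq> insert z {w\<in>V. ?E z w}"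
    using assms by (auto simp: comm_adj_def dist_commute)
  then have "card {w\<in>V. dist (pos w) (pos z) \<le> (1 - eps M) * rng M} \<le> card (insert z {w\<in>V. ?E z w})"
    using assms by (intro card_mono) auto
  also have "\<dots> \<le> card {w\<in>V. ?E z w} + 1" using assms(1) by (simp add: card_insert_if)
  also have "card {w\<in>V. ?E z w} \<le> max_degree ?E V"
    unfolding max_degree_def using assms by (intro Max_ge) auto
  finally show ?thesis by simp
qed

context sinr_model begin

text \<open>During the phases all nodes may transmit, with density at most \<open>D + 1\<close>;
  during \<open>Inter\<close> only subsets of \<open>H\<close> do, with density at most
  \<open>KH\<close>.\<close>

definition coin :: "(nat \<Rightarrow> nat \<Rightarrow> nat) \<Rightarrow> nat \<Rightarrow> nat \<Rightarrow> nat \<Rightarrow> real" where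
  "coin L N D t = kappa / (if t < 5 * L N D then real D + 1 else real KH)"

end

locale connectBB_whp = connectBB_run M V pos I N D L h "sinr_model.coin M L"
  for M V pos I N D L h +
  fixes e :: real
  assumes D: "D = max_degree E V" and e: "e > 0"
    and L: "kappa / (real D + 1) / 2 * real l \<ge> e * log 2 (real N)"
    and h: "kappa / real KH / 2 * real (h N) \<ge> e * log 2 (real N)"
begin

definition delta :: real where "delta = real N powr (- e)"

lemma fail_prob:
  assumes S: "S \<subseteq> V" and E: "E v u" and v: "v \<in> S" and K: "K \<ge> 1"
    and dens: "\<And>z. z \<in> V \<Longrightarrow> real (card {w\<in>S. dst w z \<le> R}) \<le> K"
    and J: "J \<subseteq> {..<5 * l + 2 * h N}" and q: "\<And>t. t \<in> J \<Longrightarrow> coin L N D t = kappa / K"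
    and large: "kappa / K / 2 * real (card J) \<ge> e * log 2 (real N)"
  shows "measure_pmf.prob tapes {\<tau>. \<forall>t\<in>J. \<not> sinr_rec M pos V {w\<in>S. t \<in> \<tau> w} v u} \<le> delta"
proof -
  have vu: "v \<in> V" "u \<in> V" "v \<noteq> u" "dst v u \<le> R" using E by (auto simp: E_iff)
  have "measure_pmf.prob tapes {\<tau>. \<forall>t\<in>J. \<not> sinr_rec M pos V {w\<in>S. t \<in> \<tau> w} v u}
      \<le> (1 - kappa / K / 2) ^ card J"
    by (rule tapes_fail_prob[OF finV S v vu(2) inj vu(3,4) K refl dens J q])
  also have "\<dots> \<le> delta" unfolding delta_def
  proof (rule one_minus_power_le_powr[OF _ _ N e large])
    show "0 \<le> kappa / K / 2" using kappa_pos K by simp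
    show "kappa / K / 2 \<le> 1" using kappa_pos kappa_le K by (simp add: field_simps)
  qed
  finally show ?thesis .
qed

text \<open>The edge condition makes the event empty for pairs that are not edges, so the union
  bound may run over all pairs.\<close>

definition fail_phase :: "nat \<Rightarrow> nat \<Rightarrow> nat \<Rightarrow> (nat \<Rightarrow> nat set) set" where
  "fail_phase k u v = {\<tau>. E u v \<and> (\<forall>i\<in>{k*l..<Suc k*l}. \<not> sinr_rec M pos V (on \<tau> i) u v)}"

definition fail_inter :: "nat \<Rightarrow> nat \<Rightarrow> (nat \<Rightarrow> nat set) set" where
  "fail_inter u v = {\<tau>. u \<in> H \<and> E u v \<and> (\<forall>i\<in>{5*l..<5*l + h N}. \<not> sinr_rec M pos V {w\<in>H. i \<in> \<tau> w} u v)}"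

definition fail_deliver :: "nat \<Rightarrow> nat \<Rightarrow> (nat \<Rightarrow> nat set) set" where
  "fail_deliver u v = {\<tau>. u \<in> I \<and> E u v \<and> (\<forall>i\<in>{5*l + h N..<5*l + 2 * h N}. \<not> sinr_rec M pos V {w\<in>I. i \<in> \<tau> w} u v)}"

lemma fail_phase_prob: "k < 5 \<Longrightarrow> measure_pmf.prob tapes (fail_phase k u v) \<le> delta"
proof (cases "E u v")
  case True
  assume k: "k < 5"
  have le: "Suc k * l \<le> 5 * l" using k by (intro mult_right_mono) auto
  have "measure_pmf.prob tapes {\<tau>. \<forall>i\<in>{k*l..<Suc k*l}. \<not> sinr_rec M pos V (on \<tau> i) u v} \<le> delta"
  proof (rule fail_prob[OF subset_refl True])
    show "real (card {w\<in>V. dst w z \<le> R}) \<le> real D + 1" if "z \<in> V" for z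
      using card_ball_le_max_degree[OF finV that, of pos M] unfolding D R_def by simp
    show "coin L N D t = kappa / (real D + 1)" if "t \<in> {k*l..<Suc k*l}" for t
    proof -
      have "t < 5 * l" using that le by (auto intro: less_le_trans)
      then show ?thesis by (simp add: coin_def)
    qed
    show "{k*l..<Suc k*l} \<subseteq> {..<5 * l + 2 * h N}"
    proof
      fix t assume "t \<in> {k*l..<Suc k*l}"
      then have "t < 5 * l" using le by (auto intro: less_le_trans)
      then show "t \<in> {..<5 * l + 2 * h N}" by simp
    qed
  qed (use True L in \<open>auto simp: E_iff\<close>)
  then show ?thesis using True by (simp add: fail_phase_def)
qed (simp add: fail_phase_def delta_def)

lemma fail_inter_prob: "measure_pmf.prob tapes (fail_inter u v) \<le> delta"
proof (cases "u \<in> H \<and> E u v")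
  case True
  have "measure_pmf.prob tapes {\<tau>. \<forall>i\<in>{5*l..<5*l + h N}. \<not> sinr_rec M pos V {w\<in>H. i \<in> \<tau> w} u v} \<le> delta"
    by (rule fail_prob[OF H_sub, where K = "real KH"])
       (use True h H_density in \<open>auto simp: coin_def, simp add: KH_def\<close>)
  then show ?thesis using True by (simp add: fail_inter_def)
qed (auto simp: fail_inter_def delta_def)

lemma fail_deliver_prob: "measure_pmf.prob tapes (fail_deliver u v) \<le> delta"
proof (cases "u \<in> I \<and> E u v")
  case True
  have "measure_pmf.prob tapes {\<tau>. \<forall>i\<in>{5*l + h N..<5*l + 2 * h N}. \<not> sinr_rec M pos V {w\<in>I. i \<in> \<tau> w} u v} \<le> delta"
    by (rule fail_prob[OF I_sub, where K = "real KH"])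
       (use True h I_density in \<open>auto simp: coin_def, simp add: KH_def\<close>)
  then show ?thesis using True by (simp add: fail_deliver_def)
qed (auto simp: fail_deliver_def delta_def)

text \<open>Union bound: five phases and two halves of \<open>Inter\<close>, each over at most
  \<open>N^2\<close> ordered pairs.\<close>

lemma whp: "measure_pmf.prob tapes {\<tau>. phases_ok \<tau> \<and> protocols_ok \<tau>} \<ge> 1 - 7 * (real N)\<^sup>2 * delta"
proof -
  let ?P = "\<lambda>B. measure_pmf.prob tapes B"
  let ?B1 = "\<Union>(k,u,v)\<in>{..<5} \<times> V \<times> V. fail_phase k u v"
  let ?B2 = "\<Union>(u,v)\<in>V \<times> V. fail_inter u v"
  let ?B3 = "\<Union>(u,v)\<in>V \<times> V. fail_deliver u v"
  have cV: "real (card V) \<le> real N" using card_mono[OF _ VN] by simp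
  have d0: "delta \<ge> 0" by (simp add: delta_def)
  have sq: "real (card V) * real (card V) * delta \<le> (real N)\<^sup>2 * delta"
    unfolding power2_eq_square using cV d0 by (intro mult_right_mono mult_mono) auto
  have sub: "{\<tau>. \<not> (phases_ok \<tau> \<and> protocols_ok \<tau>)} \<subseteq> ?B1 \<union> (?B2 \<union> ?B3)"
  proof
    fix \<tau> assume \<tau>: "\<tau> \<in> {\<tau>. \<not> (phases_ok \<tau> \<and> protocols_ok \<tau>)}"
    show "\<tau> \<in> ?B1 \<union> (?B2 \<union> ?B3)"
    proof (rule ccontr)
      assume *: "\<tau> \<notin> ?B1 \<union> (?B2 \<union> ?B3)"
      have "phases_ok \<tau>" unfolding phases_ok_def
      proof (intro allI impI)
        fix k u v :: nat assume k: "k < 5" and uv: "E u v"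
        then have "\<tau> \<notin> fail_phase k u v" using * by (auto simp: E_iff)
        then obtain i where i: "i \<in> {k*l..<Suc k*l}" "sinr_rec M pos V (on \<tau> i) u v"
          using uv by (auto simp: fail_phase_def)
        have "i div l = k" using i(1) by (intro div_nat_eqI) (auto simp: mult.commute)
        then show "\<exists>i. i div l = k \<and> sinr_rec M pos V (on \<tau> i) u v" using i by blast
      qed
      moreover have "protocols_ok \<tau>"
        unfolding protocols_ok_def
      proof (intro conjI ballI impI)
        fix u v assume "u \<in> H" "v \<in> H" "E u v"
        moreover from this have "\<tau> \<notin> fail_inter u v" using * by (auto simp: E_iff)
        ultimately show "\<exists>i\<in>{5*l..<5*l + h N}. sinr_rec M pos V {w\<in>H. i \<in> \<tau> w} u v"
          by (auto simp: fail_inter_def)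
      next
        fix u v assume "u \<in> I" "v \<in> V" "E u v"
        moreover from this have "\<tau> \<notin> fail_deliver u v" using * by (auto simp: E_iff)
        ultimately show "\<exists>i\<in>{5*l + h N..<5*l + 2 * h N}. sinr_rec M pos V {w\<in>I. i \<in> \<tau> w} u v"
          by (auto simp: fail_deliver_def)
      qed
      ultimately show False using \<tau> by simp
    qed
  qed
  have b1: "?P ?B1 \<le> 5 * ((real N)\<^sup>2 * delta)"
  proof -
    have "?P ?B1 \<le> real (card ({..<5::nat} \<times> V \<times> V)) * delta"
      using finV fail_phase_prob
      by (intro order_trans[OF measure_pmf.finite_measure_subadditive_finite] order_trans[OF sum_bounded_above[where K = delta]]) auto
    then show ?thesis using sq by (simp add: card_cartesian_product mult.assoc)
  qed
  have b2: "?P ?B2 \<le> (real N)\<^sup>2 * delta"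
  proof -
    have "?P ?B2 \<le> real (card (V \<times> V)) * delta"
      using finV fail_inter_prob
      by (intro order_trans[OF measure_pmf.finite_measure_subadditive_finite] order_trans[OF sum_bounded_above[where K = delta]]) auto
    then show ?thesis using sq by (simp add: card_cartesian_product)
  qed
  have b3: "?P ?B3 \<le> (real N)\<^sup>2 * delta"
  proof -
    have "?P ?B3 \<le> real (card (V \<times> V)) * delta"
      using finV fail_deliver_prob
      by (intro order_trans[OF measure_pmf.finite_measure_subadditive_finite] order_trans[OF sum_bounded_above[where K = delta]]) auto
    then show ?thesis using sq by (simp add: card_cartesian_product)
  qed
  have "?P {\<tau>. \<not> (phases_ok \<tau> \<and> protocols_ok \<tau>)} \<le> ?P (?B1 \<union> (?B2 \<union> ?B3))"
    using sub by (intro measure_pmf.finite_measure_mono) auto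
  also have "\<dots> \<le> ?P ?B1 + ?P (?B2 \<union> ?B3)" by (intro measure_subadditive) auto
  also have "?P (?B2 \<union> ?B3) \<le> ?P ?B2 + ?P ?B3" by (intro measure_subadditive) auto
  finally have "?P {\<tau>. \<not> (phases_ok \<tau> \<and> protocols_ok \<tau>)} \<le> 7 * (real N)\<^sup>2 * delta"
    using b1 b2 b3 by simp
  moreover have "?P {\<tau>. \<not> (phases_ok \<tau> \<and> protocols_ok \<tau>)} = 1 - ?P {\<tau>. phases_ok \<tau> \<and> protocols_ok \<tau>}"
  proof -
    have "{\<tau>. \<not> (phases_ok \<tau> \<and> protocols_ok \<tau>)} = space tapes - {\<tau>. phases_ok \<tau> \<and> protocols_ok \<tau>}" by auto
    then show ?thesis using measure_pmf.prob_compl[of "{\<tau>. phases_ok \<tau> \<and> protocols_ok \<tau>}" tapes] by simp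
  qed
  ultimately show ?thesis by linarith
qed

end

section \<open>Choice of the constants and conclusion\<close>

lemma nat_ceiling_le:
  fixes x :: real
  assumes "x \<ge> 1"
  shows "real (nat \<lceil>x\<rceil>) \<le> 2 * x"
  using assms by linarith

theorem theorem3:
  fixes M :: sinr
  assumes "alpha M > 2" and "noise M > 0" and "pw M > 0" and "beta M \<ge> 1"
      and "0 < eps M" and "eps M < 1"
  shows "\<forall>d::real. d > 0 \<longrightarrow>
    (\<exists>(A::alg) (cm::nat) (cb::real) (cT::real) (c1::real) (c2::real) (a1::nat \<Rightarrow> nat \<Rightarrow> nat) (a2::nat \<Rightarrow> nat \<Rightarrow> nat).
       (\<forall>N D. N \<ge> 2 \<longrightarrow> real (a_rounds A N D) \<le> cT * real (max 1 D) * log 2 (real N) ^ 7)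
     \<and> (\<forall>N D. N \<ge> 2 \<longrightarrow> real (a1 N D) \<le> c1 * log 2 (real N))
     \<and> (\<forall>N D. N \<ge> 2 \<longrightarrow> real (a2 N D) \<le> c2 * real (max 1 D) * log 2 (real N))
     \<and> (\<forall>(N::nat) (V::nat set) (pos::nat \<Rightarrow> pt) (I::nat set).
          N \<ge> 2 \<and> finite V \<and> V \<noteq> {} \<and> V \<subseteq> {1..N} \<and> inj_on pos V
          \<and> connected_on (comm_adj M pos V) V \<and> is_mis (comm_adj M pos V) V I \<longrightarrow>
          (let D = max_degree (comm_adj M pos V) V;
               c0 = (\<lambda>v. a_init A v N D (v \<in> I));
               p = run M pos V (N ^ cm) A c0 (a_rounds A N D)
           in measure_pmf.prob p
                {cfg. backbone_ok M pos V cb (a1 N D) (a2 N D) (\<lambda>v. a_out A (cfg v))}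
              \<ge> 1 - real (card V) powr (- d))))"
proof (intro allI impI)
  fix d :: real assume d: "d > 0"
  interpret sinr_model M using assms by unfold_locales
  \<comment> \<open>The surplus 5 absorbs the union bound, since \<open>7 * N^2 \<le> N^5\<close>
    for \<open>N \<ge> 2\<close>.\<close>
  define e where "e = d + 5"
  \<comment> \<open>One factor 2 undoes the halving in the success probability \<open>p / 2\<close>,
    the other comes from \<open>D + 1 \<le> 2 * max 1 D\<close>.\<close>
  define C where "C = 4 * e / kappa"
  \<comment> \<open>Cancels the success probability \<open>kappa / real KH / 2\<close> per round
    exactly.\<close>
  define C' where "C' = 2 * real KH * e / kappa"
  define L where "L N D = nat \<lceil>C * (real (max 1 D) * log 2 (real N))\<rceil>" for N D
  define h where "h N = nat \<lceil>C' * log 2 (real N)\<rceil>" for N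
  let ?A = "connectBB L h (coin L)"
  have e: "e > 0" using d by (simp add: e_def)
  \<comment> \<open>Constants at least 1 keep the arguments of the ceilings at least 1, so that
    rounding up at most doubles them.\<close>
  have C: "C \<ge> 1" and C': "C' \<ge> 1"
    using d kappa_pos kappa_le by (auto simp: C_def C'_def e_def KH_def field_simps)
  have lg: "log 2 (real N) \<ge> 1" if "N \<ge> 2" for N using that by (simp add: le_log_iff)
  have mlg: "real (max 1 D) * log 2 (real N) \<ge> 1" if "N \<ge> 2" for N D
    using mult_mono[of 1 "real (max 1 D)" 1 "log 2 (real N)"] lg[OF that] by simp
  have Lb: "real (L N D) \<le> 2 * C * real (max 1 D) * log 2 (real N)" if "N \<ge> 2" for N D
    using nat_ceiling_le[of "C * (real (max 1 D) * log 2 (real N))"]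
      mult_mono[OF C mlg[OF that, of D]] C by (simp add: L_def mult.assoc)
  have hb: "real (h N) \<le> 2 * C' * log 2 (real N)" if "N \<ge> 2" for N
    using nat_ceiling_le[of "C' * log 2 (real N)"] mult_mono[OF C' lg[OF that]] C' by (simp add: h_def)
  show "\<exists>(A::alg) (cm::nat) (cb::real) (cT::real) (c1::real) (c2::real) (a1::nat \<Rightarrow> nat \<Rightarrow> nat) (a2::nat \<Rightarrow> nat \<Rightarrow> nat).
       (\<forall>N D. N \<ge> 2 \<longrightarrow> real (a_rounds A N D) \<le> cT * real (max 1 D) * log 2 (real N) ^ 7)
     \<and> (\<forall>N D. N \<ge> 2 \<longrightarrow> real (a1 N D) \<le> c1 * log 2 (real N))
     \<and> (\<forall>N D. N \<ge> 2 \<longrightarrow> real (a2 N D) \<le> c2 * real (max 1 D) * log 2 (real N))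
     \<and> (\<forall>(N::nat) (V::nat set) (pos::nat \<Rightarrow> pt) (I::nat set).
          N \<ge> 2 \<and> finite V \<and> V \<noteq> {} \<and> V \<subseteq> {1..N} \<and> inj_on pos V
          \<and> connected_on (comm_adj M pos V) V \<and> is_mis (comm_adj M pos V) V I \<longrightarrow>
          (let D = max_degree (comm_adj M pos V) V;
               c0 = (\<lambda>v. a_init A v N D (v \<in> I));
               p = run M pos V (N ^ cm) A c0 (a_rounds A N D)
           in measure_pmf.prob p
                {cfg. backbone_ok M pos V cb (a1 N D) (a2 N D) (\<lambda>v. a_out A (cfg v))}
              \<ge> 1 - real (card V) powr (- d)))"
  \<comment> \<open>\<open>1 + 10 * C\<close> accounts for the drawing round and for five phases of
    length at most \<open>2 * C * max 1 D * log 2 N\<close>; 340 is the exponent of the message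
    bound.\<close>
  proof (rule exI[of _ ?A], rule exI[of _ 340], rule exI[of _ "real KH"], rule exI[of _ "1 + 10 * C"],
      rule exI[of _ "4 * C'"], rule exI[of _ "2 * C"], rule exI[of _ "\<lambda>N D. 2 * h N"], rule exI[of _ L],
      intro conjI allI impI)
    fix N D :: nat assume N: "N \<ge> 2"
    have "real (a_rounds ?A N D) = 1 + 5 * real (L N D)" by (simp add: connectBB_def)
    also have "\<dots> \<le> real (max 1 D) * log 2 (real N) + 5 * (2 * C * real (max 1 D) * log 2 (real N))"
      using Lb[OF N] mlg[OF N] by (intro add_mono mult_left_mono) auto
    also have "\<dots> = (1 + 10 * C) * real (max 1 D) * log 2 (real N)" by (simp add: algebra_simps)
    \<comment> \<open>The logarithm is at least 1, so it is bounded by its seventh power.\<close>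
    also have "\<dots> \<le> (1 + 10 * C) * real (max 1 D) * log 2 (real N) ^ 7"
      using C lg[OF N] power_increasing[of 1 7 "log 2 (real N)"] by (intro mult_left_mono) auto
    finally show "real (a_rounds ?A N D) \<le> (1 + 10 * C) * real (max 1 D) * log 2 (real N) ^ 7" .
    show "real (2 * h N) \<le> 4 * C' * log 2 (real N)" using hb[OF N] by simp
    show "real (L N D) \<le> 2 * C * real (max 1 D) * log 2 (real N)" by (rule Lb[OF N])
  next
    fix N :: nat and V :: "nat set" and pos :: "nat \<Rightarrow> pt" and I :: "nat set"
    assume *: "N \<ge> 2 \<and> finite V \<and> V \<noteq> {} \<and> V \<subseteq> {1..N} \<and> inj_on pos V
          \<and> connected_on (comm_adj M pos V) V \<and> is_mis (comm_adj M pos V) V I"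
    define D where "D = max_degree (comm_adj M pos V) V"
    have N: "N \<ge> 2" using * by simp
    have scale: "2 * e * (m / a) * g = k / a / 2 * (4 * e / k * (m * g))"
      if "k \<noteq> 0" "a \<noteq> 0" for k a e m g :: real
      using that by (simp add: field_simps)
    have Lge: "real (L N D) \<ge> C * (real (max 1 D) * log 2 (real N))" unfolding L_def by linarith
    have hge: "real (h N) \<ge> C' * log 2 (real N)" unfolding h_def by linarith
    interpret connectBB_whp M V pos I N D L h e
    proof unfold_locales
      have "C * (real (max 1 D) * log 2 (real N)) \<ge> 1" using mult_mono[OF C mlg[OF N, of D]] C by simp
      then have "real (L N D) \<ge> 1" using Lge by linarith
      then show "0 < L N D" by simp
      have "e * log 2 (real N) \<le> 2 * e * (real (max 1 D) / (real D + 1)) * log 2 (real N)"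
        using e lg[OF N] by (intro mult_right_mono) (auto simp: field_simps max_def)
      also have "\<dots> = kappa / (real D + 1) / 2 * (C * (real (max 1 D) * log 2 (real N)))"
        using scale[of kappa "real D + 1" e] kappa_pos unfolding C_def by simp
      also have "\<dots> \<le> kappa / (real D + 1) / 2 * real (L N D)"
        using kappa_pos Lge by (intro mult_left_mono) auto
      finally show "e * log 2 (real N) \<le> kappa / (real D + 1) / 2 * real (L N D)" .
      have "e * log 2 (real N) = kappa / real KH / 2 * (C' * log 2 (real N))"
        using kappa_pos by (simp add: C'_def KH_def)
      also have "\<dots> \<le> kappa / real KH / 2 * real (h N)"
        using kappa_pos hge by (intro mult_left_mono) auto
      finally show "e * log 2 (real N) \<le> kappa / real KH / 2 * real (h N)" .
    qed (use * e in \<open>auto simp: D_def\<close>)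
    have n: "1 \<le> card V" "card V \<le> N" using * card_mono[of "{1..N}" V] by (auto simp: Suc_le_eq card_gt_0_iff)
    have "7 * (real N)\<^sup>2 * delta \<le> (real N) ^ 5 * delta"
    proof (rule mult_right_mono)
      have "(2::real) ^ 3 \<le> real N ^ 3" using N by (intro power_mono) auto
      then have "7 * (real N)\<^sup>2 \<le> real N ^ 3 * (real N)\<^sup>2" by (intro mult_right_mono) auto
      then show "7 * (real N)\<^sup>2 \<le> (real N) ^ 5" by (simp flip: power_add)
    qed (simp add: delta_def)
    also have "\<dots> = real N powr 5 * real N powr (- e)"
      using N by (simp add: delta_def powr_numeral)
    also have "\<dots> = real N powr (- d)" unfolding powr_add[symmetric] by (simp add: e_def)
    \<comment> \<open>The bound in \<open>N\<close> implies the one in \<open>card V\<close>,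
      because \<open>card V \<le> N\<close> and the exponent is negative.\<close>
    also have "\<dots> \<le> real (card V) powr (- d)" using n d by (intro powr_mono2') auto
    finally have "1 - real (card V) powr (- d) \<le> 1 - 7 * (real N)\<^sup>2 * delta" by simp
    also have "\<dots> \<le> measure_pmf.prob tapes {\<tau>. phases_ok \<tau> \<and> protocols_ok \<tau>}" by (rule whp)
    also have "\<dots> \<le> measure_pmf.prob (run M pos V (N ^ 340) ?A init (a_rounds ?A N D))
     {c. backbone_ok M pos V (real KH) (2 * h N) (L N D) (\<lambda>v. a_out ?A (c v))}" by (rule success_ge)
    finally show "let D = max_degree (comm_adj M pos V) V;
               c0 = (\<lambda>v. a_init ?A v N D (v \<in> I));
               p = run M pos V (N ^ 340) ?A c0 (a_rounds ?A N D)
           in measure_pmf.prob p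
                {cfg. backbone_ok M pos V (real KH) (2 * h N) (L N D) (\<lambda>v. a_out ?A (cfg v))}
              \<ge> 1 - real (card V) powr (- d)"
      by (simp add: Let_def init_def[abs_def] flip: D_def)
  qed
qed

end
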